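(* If $\rho:\mathsf T^d\to\mathsf{SO}(V)$ is a faithful representation with only connected isotropy groups, then $\rho$ has at most $\frac{d(d+1)}{2}$ non-trivial, pairwise inequivalent, irreducible subrepresentations. Moreover, equality holds if and only if there is a basis $e_1,\dots,e_d$ of the dual of the Lie algebra of $\mathsf T^d$ such that the weights of the representation are given by $$e_1,\dots,e_d,\qquad e_i-e_j\quad\text{for}\quad 1\le i<j\le d.$$
   Context: $\mathsf T^d$ is the $d$-dimensional torus with Lie algebra $\mathfrak t$ and $V$ is a finite-dimensional real Euclidean vector space. The isotropy groups are the groups $\{g\in\mathsf T^d: \rho(g)v=v\}$, $v\in V$. Subrepresentations are real. A non-trivial irreducible subrepresentation is two-dimensional, given by a homomorphism $\mathsf T^d\to\mathsf S^1\cong \mathsf{SO}(2)$ of the form $\exp(v)\mapsto e^{2\pi i h(v)}$ with $0\ne h\in\mathfrak t^*$; its weight is $h$, which is determined up to sign by the equivalence class. "The weights of the representation" refers to the set of weights (each up to sign, without multiplicity) of its non-trivial irreducible subrepresentations. *)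

theory Defs
  imports "HOL-Analysis.Analysis"
begin

text \<open>The torus of dimension \<open>CARD('d)\<close>, a group under the componentwise multiplication of vectors.\<close>

definition torus :: "(complex ^ 'd) set" where
  "torus = {z. \<forall>i. cmod (z $ i) = 1}"

text \<open>The Lie algebra of \<^const>\<open>torus\<close> is \<open>real ^ 'd\<close>; the kernel of the exponential map is the
  standard integral lattice. The dual of the Lie algebra is \<open>(real ^ 'd) \<Rightarrow>\<^sub>L real\<close>, as all linear
  functionals on a finite-dimensional space are bounded.\<close>

definition torus_exp :: "real ^ 'd \<Rightarrow> complex ^ 'd" where
  "torus_exp x = (\<chi> i. cis (2 * pi * x $ i))"

text \<open>The library has determinants of matrices only; this is the Leibniz formula for the matrix
  of \<open>f\<close> with respect to the standard orthonormal basis.\<close>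

definition lin_det :: "('v::euclidean_space \<Rightarrow> 'v) \<Rightarrow> real" where
  "lin_det f = (\<Sum>p | p permutes Basis. of_int (sign p) * (\<Prod>b\<in>Basis. f (p b) \<bullet> b))"

definition special_orthogonal :: "('v::euclidean_space \<Rightarrow> 'v) set" where
  "special_orthogonal = {f. orthogonal_transformation f \<and> lin_det f = 1}"

text \<open>Continuous homomorphisms from the torus to \<open>SO(V)\<close>. Since \<open>V\<close> is finite-dimensional,
  continuity of all orbit maps is the same as continuity into the space of linear maps. Only the
  values of \<open>\<rho>\<close> on \<^const>\<open>torus\<close> are relevant.\<close>

definition torus_rep :: "(complex ^ 'd \<Rightarrow> 'v::euclidean_space \<Rightarrow> 'v) \<Rightarrow> bool" where
  "torus_rep \<rho> \<longleftrightarrow>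
     \<rho> ` torus \<subseteq> special_orthogonal \<and>
     (\<forall>z\<in>torus. \<forall>w\<in>torus. \<rho> (z * w) = \<rho> z \<circ> \<rho> w) \<and>
     (\<forall>v. continuous_on torus (\<lambda>z. \<rho> z v))"

definition faithful_rep :: "(complex ^ 'd \<Rightarrow> 'v::euclidean_space \<Rightarrow> 'v) \<Rightarrow> bool" where
  "faithful_rep \<rho> \<longleftrightarrow> torus_rep \<rho> \<and> inj_on \<rho> torus"

definition isotropy_group ::
    "(complex ^ 'd \<Rightarrow> 'v::euclidean_space \<Rightarrow> 'v) \<Rightarrow> 'v \<Rightarrow> (complex ^ 'd) set" where
  "isotropy_group \<rho> v = {z \<in> torus. \<rho> z v = v}"

definition subrep :: "(complex ^ 'd \<Rightarrow> 'v::euclidean_space \<Rightarrow> 'v) \<Rightarrow> 'v set \<Rightarrow> bool" where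
  "subrep \<rho> W \<longleftrightarrow> subspace W \<and> (\<forall>z\<in>torus. \<rho> z ` W \<subseteq> W)"

definition irreducible_subrep ::
    "(complex ^ 'd \<Rightarrow> 'v::euclidean_space \<Rightarrow> 'v) \<Rightarrow> 'v set \<Rightarrow> bool" where
  "irreducible_subrep \<rho> W \<longleftrightarrow>
     subrep \<rho> W \<and> W \<noteq> {0} \<and> (\<forall>U. subrep \<rho> U \<and> U \<subseteq> W \<longrightarrow> U = {0} \<or> U = W)"

definition trivial_subrep ::
    "(complex ^ 'd \<Rightarrow> 'v::euclidean_space \<Rightarrow> 'v) \<Rightarrow> 'v set \<Rightarrow> bool" where
  "trivial_subrep \<rho> W \<longleftrightarrow> subrep \<rho> W \<and> (\<forall>z\<in>torus. \<forall>w\<in>W. \<rho> z w = w)"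

definition nontrivial_irreducible_subreps ::
    "(complex ^ 'd \<Rightarrow> 'v::euclidean_space \<Rightarrow> 'v) \<Rightarrow> 'v set set" where
  "nontrivial_irreducible_subreps \<rho> =
     {W. irreducible_subrep \<rho> W \<and> \<not> trivial_subrep \<rho> W}"

text \<open>Equivalence of real representations. A linear isomorphism between two subspaces is
  represented by (any linear extension to) a linear map on all of \<open>V\<close>.\<close>

definition equivalent_subreps ::
    "(complex ^ 'd \<Rightarrow> 'v::euclidean_space \<Rightarrow> 'v) \<Rightarrow> 'v set \<Rightarrow> 'v set \<Rightarrow> bool" where
  "equivalent_subreps \<rho> W W' \<longleftrightarrow>
     (\<exists>f. linear f \<and> bij_betw f W W' \<and> (\<forall>z\<in>torus. \<forall>w\<in>W. f (\<rho> z w) = \<rho> z (f w)))"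

text \<open>\<open>h\<close> is a weight of \<open>W\<close> if \<open>W\<close> is equivalent to the real representation on the complex plane
  in which \<open>torus_exp x\<close> acts by multiplication by \<open>exp (2 \<pi> i h(x))\<close>. As the equivalence is only real linear,
  \<open>h\<close> and \<open>- h\<close> are weights of \<open>W\<close> simultaneously.\<close>

definition is_weight_of ::
    "(complex ^ 'd \<Rightarrow> 'v::euclidean_space \<Rightarrow> 'v) \<Rightarrow> 'v set \<Rightarrow> ((real ^ 'd) \<Rightarrow>\<^sub>L real) \<Rightarrow> bool" where
  "is_weight_of \<rho> W h \<longleftrightarrow> h \<noteq> 0 \<and>
     (\<exists>f :: 'v \<Rightarrow> complex. linear f \<and> bij_betw f W UNIV \<and>
        (\<forall>x. \<forall>w\<in>W. f (\<rho> (torus_exp x) w) = cis (2 * pi * blinfun_apply h x) * f w))"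

text \<open>This set contains both signs of each weight.\<close>

definition weights ::
    "(complex ^ 'd \<Rightarrow> 'v::euclidean_space \<Rightarrow> 'v) \<Rightarrow> ((real ^ 'd) \<Rightarrow>\<^sub>L real) set" where
  "weights \<rho> = {h. \<exists>W \<in> nontrivial_irreducible_subreps \<rho>. is_weight_of \<rho> W h}"

definition inequivalent_family ::
    "(complex ^ 'd \<Rightarrow> 'v::euclidean_space \<Rightarrow> 'v) \<Rightarrow> 'v set set \<Rightarrow> bool" where
  "inequivalent_family \<rho> \<F> \<longleftrightarrow>
     \<F> \<subseteq> nontrivial_irreducible_subreps \<rho> \<and>
     pairwise (\<lambda>W W'. \<not> equivalent_subreps \<rho> W W') \<F>"

definition is_basis_upto :: "nat \<Rightarrow> (nat \<Rightarrow> 'a::real_vector) \<Rightarrow> bool" where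
  "is_basis_upto n e \<longleftrightarrow>
     inj_on e {1..n} \<and> independent (e ` {1..n}) \<and> span (e ` {1..n}) = UNIV"

end

theory Submission
  imports Defs
begin

text \<open>
  The proof turns the hypothesis on isotropy groups into a statement about the finite set of weights
  and then proves an extremal theorem, essentially Heller's theorem on totally unimodular matrices.

  From representations to vectors. Every non-trivial irreducible subrepresentation is a rotation
  plane with a weight (\<open>nontrivial_irreducible_has_weight\<close>), and two of them are equivalent if and
  only if their weights agree up to sign. So an inequivalent family has at most half as many members
  as there are weights, both signs being counted. If \<open>S\<close> is a set of weights, no two of them opposite,
  a sum of non-zero vectors from rotation planes with the weights in \<open>S\<close> is fixed by \<open>exp y\<close>
  exactly if \<open>s(y)\<close> is an integer for every \<open>s \<in> S\<close>, because these planes are orthogonal. Connectedness of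
  this isotropy group means that such a \<open>y\<close> differs by a lattice vector from a common zero of \<open>S\<close>
  (\<open>annihilator_lift\<close>). Let \<open>S\<close> be independent and let the weight \<open>x\<close> have coefficient \<open>c \<noteq> 0\<close> at \<open>b \<in> S\<close>.
  A vector dual to \<open>b\<close> has integral values on \<open>S\<close>, hence on \<open>x\<close>, so \<open>c\<close> is an integer; exchanging \<open>b\<close>
  and \<open>x\<close> shows that \<open>1 / c\<close> is an integer too. So the weights form a unimodular system
  (\<open>unimodular_weights\<close>): all coefficients of members with respect to independent sets of members
  are \<open>-1\<close>, \<open>0\<close> or \<open>1\<close>.

  The bound. Let \<open>W\<close> be a unimodular system of rank at most \<open>n\<close> and \<open>w \<in> W\<close>. The images of
  \<open>W\<close> modulo \<open>w\<close>, without zero, form a unimodular system \<open>W / w\<close> of rank at most \<open>n - 1\<close>. A line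
  parallel to \<open>w\<close> other than the one through \<open>w\<close> contains at most two members, and the lines with two
  of them correspond to the members of \<open>D = {u \<in> W. u - w \<in> W}\<close>. Hence
  \<open>card W = 2 + card D + card (W / w)\<close>. The set \<open>D\<close> consists of pairs \<open>u, w - u\<close>, the triangles on \<open>w\<close>. A sign argument
  (\<open>sharing_triangle_basis\<close>) shows that a maximal subset of \<open>D\<close> that is independent together with \<open>w\<close>
  meets every pair, so that \<open>D\<close> has at most \<open>2 (n - 1)\<close> elements. By induction \<open>card W \<le> n (n + 1)\<close>.

  Equality. If \<open>card W = n (n + 1)\<close>, then equality holds in every step and for every \<open>w\<close>. A member
  \<open>x\<close> that lies in no triangle with \<open>w\<close> must merge two triangles on \<open>w\<close> when \<open>x\<close> is contracted, because
  \<open>W / x\<close> has room for fewer triangles on the image of \<open>w\<close>. So \<open>x\<close> is a difference of two elements of \<open>D\<close>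
  (\<open>extremal_difference\<close>). Counting these members shows that each two triangles have such a difference
  in \<open>W\<close> (\<open>extremal_pair\<close>). From each triangle a representative can then be
  chosen such that all differences of representatives lie in \<open>W\<close> (\<open>extremal_clique\<close>). These
  representatives and \<open>w\<close> are the required basis.
\<close>

section \<open>Independent families\<close>

text \<open>Independence of an indexed family. It avoids the separate treatment of coincidences that
  independence of an image set would need, since the vectors are often replaced one by one below.\<close>

definition free_family :: "'i set \<Rightarrow> ('i \<Rightarrow> 'a::real_vector) \<Rightarrow> bool" where
  "free_family I v \<longleftrightarrow> (\<forall>u. (\<Sum>i\<in>I. u i *\<^sub>R v i) = 0 \<longrightarrow> (\<forall>i\<in>I. u i = 0))"

lemma free_familyI:
  assumes "\<And>u i. (\<Sum>i\<in>I. u i *\<^sub>R v i) = 0 \<Longrightarrow> i \<in> I \<Longrightarrow> u i = 0"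
  shows "free_family I v"
  using assms unfolding free_family_def by blast

lemma free_familyD:
  assumes "free_family I v" "(\<Sum>i\<in>I. u i *\<^sub>R v i) = 0" "i \<in> I"
  shows "u i = 0"
  using assms unfolding free_family_def by blast

lemma free_family_id_iff:
  fixes S :: "'a::real_vector set"
  assumes "finite S"
  shows "free_family S (\<lambda>x. x) \<longleftrightarrow> independent S"
  unfolding dependent_finite[OF assms] free_family_def by blast

lemma free_family_inj_on:
  assumes "finite I" "free_family I v"
  shows "inj_on v I"
proof (rule inj_onI, rule ccontr)
  fix i j assume ij: "i \<in> I" "j \<in> I" "v i = v j" "i \<noteq> j"
  let ?u = "\<lambda>k. if k = i then 1 else if k = j then - 1 else (0::real)"
  have "(\<Sum>k\<in>I. ?u k *\<^sub>R v k) = (\<Sum>k\<in>{i, j}. ?u k *\<^sub>R v k)"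
    using ij assms(1) by (intro sum.mono_neutral_right) auto
  also have "\<dots> = 0" using ij by simp
  finally have "?u i = 0" using free_familyD[OF assms(2), of ?u i] ij(1) by blast
  then show False by simp
qed

lemma free_family_independent_image:
  assumes "finite I" "free_family I v"
  shows "independent (v ` I)"
proof -
  have inj: "inj_on v I" by (rule free_family_inj_on[OF assms])
  have "u x = 0" if "(\<Sum>x\<in>v ` I. u x *\<^sub>R x) = 0" "x \<in> v ` I" for u x
  proof -
    have "(\<Sum>i\<in>I. u (v i) *\<^sub>R v i) = 0"
      using that(1) by (simp add: sum.reindex[OF inj])
    then show ?thesis using free_familyD[OF assms(2), of "\<lambda>i. u (v i)"] that(2) by auto
  qed
  then have "free_family (v ` I) (\<lambda>x. x)" by (intro free_familyI)
  then show ?thesis using free_family_id_iff[of "v ` I"] assms(1) by simp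
qed

section \<open>Unimodular systems\<close>

text \<open>The coefficients are tested only against independent sets of members. This form of total
  unimodularity needs neither coordinates nor a lattice and passes directly to quotients.\<close>

definition unimodular_system :: "'a::real_vector set \<Rightarrow> bool" where
  "unimodular_system W \<longleftrightarrow> 0 \<notin> W \<and> (\<forall>x\<in>W. - x \<in> W) \<and>
     (\<forall>S c. finite S \<longrightarrow> S \<subseteq> W \<longrightarrow> independent S \<longrightarrow> (\<Sum>b\<in>S. c b *\<^sub>R b) \<in> W \<longrightarrow>
        (\<forall>b\<in>S. c b \<in> {-1, 0, 1 :: real}))"

lemma unimodular_nonzero: "unimodular_system W \<Longrightarrow> x \<in> W \<Longrightarrow> x \<noteq> 0"
  by (auto simp: unimodular_system_def)

lemma unimodular_uminus_iff: "unimodular_system W \<Longrightarrow> - x \<in> W \<longleftrightarrow> x \<in> W"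
  unfolding unimodular_system_def by (metis minus_minus)

lemma unimodular_diff_commute: "unimodular_system W \<Longrightarrow> x - y \<in> W \<longleftrightarrow> y - x \<in> W"
  using unimodular_uminus_iff[of W "x - y"] by simp

lemma unimodular_systemD:
  assumes "unimodular_system W" "finite S" "S \<subseteq> W" "independent S" "(\<Sum>b\<in>S. c b *\<^sub>R b) \<in> W"
  shows "\<forall>b\<in>S. c b \<in> {-1, 0, 1}"
  using assms unfolding unimodular_system_def by blast

lemma unimodular_coefficient:
  assumes W: "unimodular_system W" and I: "finite I" and v: "v ` I \<subseteq> W"
    and free: "free_family I v" and x: "(\<Sum>i\<in>I. c i *\<^sub>R v i) \<in> W" and i: "i \<in> I"
  shows "c i \<in> {-1, 0, 1}"
proof -
  have inj: "inj_on v I" by (rule free_family_inj_on[OF I free])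
  let ?c = "\<lambda>x. c (inv_into I v x)"
  have "(\<Sum>x\<in>v ` I. ?c x *\<^sub>R x) = (\<Sum>i\<in>I. c i *\<^sub>R v i)"
    by (simp add: sum.reindex[OF inj] inj)
  then have "(\<Sum>x\<in>v ` I. ?c x *\<^sub>R x) \<in> W" using x by simp
  then have "\<forall>x\<in>v ` I. ?c x \<in> {-1, 0, 1}"
    using unimodular_systemD[OF W _ v free_family_independent_image[OF I free]] I by simp
  then have "?c (v i) \<in> {-1, 0, 1}" using i by blast
  then show ?thesis using inj i by simp
qed

definition rank_at_most :: "'a::real_vector set \<Rightarrow> nat \<Rightarrow> bool" where
  "rank_at_most W n \<longleftrightarrow> (\<forall>S\<subseteq>W. independent S \<longrightarrow> finite S \<and> card S \<le> n)"

lemma rank_at_most_card: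
  assumes "rank_at_most W n" "finite I" "v ` I \<subseteq> W" "free_family I v"
  shows "card I \<le> n"
  using assms free_family_independent_image[of I v] card_image[OF free_family_inj_on[of I v]]
  unfolding rank_at_most_def by metis

text \<open>In a basis of members each member is described by a vector with entries in \<open>{-1, 0, 1}\<close>.\<close>

lemma unimodular_finite:
  assumes W: "unimodular_system W" and n: "rank_at_most W n"
  shows "finite W"
proof -
  obtain B where B: "B \<subseteq> W" "independent B" "W \<subseteq> span B"
    using maximal_independent_subset by blast
  then have fin: "finite B" using n unfolding rank_at_most_def by blast
  have "W \<subseteq> (\<lambda>c. \<Sum>b\<in>B. c b *\<^sub>R b) ` (PiE B (\<lambda>_. {-1, 0, 1 :: real}))"
  proof
    fix x assume x: "x \<in> W"
    then obtain c where c: "x = (\<Sum>b\<in>B. c b *\<^sub>R b)"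
      using B(3) span_finite[OF fin] by blast
    have "\<forall>b\<in>B. c b \<in> {-1, 0, 1}"
      using unimodular_systemD[OF W fin B(1,2)] x c by blast
    moreover have "x = (\<Sum>b\<in>B. restrict c B b *\<^sub>R b)" unfolding c by (rule sum.cong) auto
    ultimately show "x \<in> (\<lambda>c. \<Sum>b\<in>B. c b *\<^sub>R b) ` (PiE B (\<lambda>_. {-1, 0, 1 :: real}))"
      by (intro image_eqI[where x = "restrict c B"]) auto
  qed
  moreover have "finite (PiE B (\<lambda>_. {-1, 0, 1 :: real}))" using fin by (intro finite_PiE) auto
  ultimately show ?thesis using finite_surj by blast
qed

lemma unimodular_multiple:
  assumes W: "unimodular_system W" and "w \<in> W" "k *\<^sub>R w \<in> W"
  shows "k = 1 \<or> k = - 1"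
proof -
  have "free_family {w} (\<lambda>x. x)"
    using unimodular_nonzero[OF W] assms(2) by (intro free_familyI) auto
  then have "k \<in> {-1, 0, 1}"
    using unimodular_coefficient[OF W, of "{w}" "\<lambda>x. x" "\<lambda>_. k"] assms by auto
  moreover have "k \<noteq> 0" using unimodular_nonzero[OF W assms(3)] by auto
  ultimately show ?thesis by auto
qed

lemma unimodular_two:
  assumes W: "unimodular_system W" and "w \<in> W" "x \<in> W" "x \<noteq> w" "x \<noteq> - w"
    and y: "a *\<^sub>R x + b *\<^sub>R w \<in> W"
  shows "a \<in> {-1, 0, 1}" "b \<in> {-1, 0, 1}"
proof -
  have free: "free_family {x, w} (\<lambda>x. x)"
  proof (rule free_familyI)
    fix u i assume "(\<Sum>i\<in>{x, w}. u i *\<^sub>R i) = 0" and i: "i \<in> {x, w}"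
    then have s: "u x *\<^sub>R x + u w *\<^sub>R w = 0" using assms(4) by simp
    have "u x = 0"
    proof (rule ccontr)
      assume n: "u x \<noteq> 0"
      have "x = (1 / u x) *\<^sub>R (u x *\<^sub>R x)" using n by simp
      also have "u x *\<^sub>R x = - (u w *\<^sub>R w)" using s by (simp add: eq_neg_iff_add_eq_0)
      finally have "x = (- u w / u x) *\<^sub>R w" by simp
      then show False using unimodular_multiple[OF W assms(2)] assms(3-5)
        by (metis scaleR_minus1_left scaleR_one)
    qed
    moreover from this have "u w = 0" using s unimodular_nonzero[OF W assms(2)] by simp
    ultimately show "u i = 0" using i by auto
  qed
  let ?c = "\<lambda>i. if i = x then a else b"
  have "(\<Sum>i\<in>{x, w}. ?c i *\<^sub>R i) \<in> W" using y assms(4) by simp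
  then have "?c i \<in> {-1, 0, 1}" if "i \<in> {x, w}" for i
    using unimodular_coefficient[OF W _ _ free, of ?c i] assms that by auto
  from this[of x] this[of w] show "a \<in> {-1, 0, 1}" "b \<in> {-1, 0, 1}" using assms(4) by auto
qed

section \<open>Triangles in a unimodular system\<close>

text \<open>The triangles in \<open>W\<close> with side \<open>w\<close>: the vector \<open>u\<close> is one of the other two sides, and \<open>w - u\<close>, the
  remaining one, lies in this set as well if \<open>W\<close> is symmetric.\<close>

definition sharing_triangle :: "'a::real_vector set \<Rightarrow> 'a \<Rightarrow> 'a set" where
  "sharing_triangle W w = {u \<in> W. u - w \<in> W}"

lemma sharing_triangle_not_multiple:
  assumes W: "unimodular_system W" and w: "w \<in> W" and u: "u \<in> sharing_triangle W w"
  shows "u \<noteq> w" "u \<noteq> - w"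
proof -
  show "u \<noteq> w" using u unimodular_nonzero[OF W, of "u - w"] by (auto simp: sharing_triangle_def)
  show "u \<noteq> - w"
  proof
    assume "u = - w"
    then have "(- 2) *\<^sub>R w \<in> W" using u by (simp add: sharing_triangle_def scaleR_2)
    then show False using unimodular_multiple[OF W w] by fastforce
  qed
qed

lemma sharing_triangle_flip:
  assumes W: "unimodular_system W" and u: "u \<in> sharing_triangle W w"
  shows "w - u \<in> sharing_triangle W w"
  using u unimodular_diff_commute[OF W] unimodular_uminus_iff[OF W]
  by (auto simp: sharing_triangle_def)

text \<open>Replacing some vectors \<open>h\<close> of a basis by \<open>w - h\<close> changes their coefficients by a sign only, and the
  coefficient of \<open>w\<close> by the sum of the coefficients concerned. This makes the coefficient of \<open>w\<close> adjustable,
  which \<open>sharing_triangle_basis\<close> exploits.\<close>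

lemma sum_flip_subset:
  fixes w :: "'a::real_vector"
  assumes "finite H" "A \<subseteq> H"
  shows "(\<Sum>h\<in>H. (if h \<in> A then - c h else c h) *\<^sub>R (if h \<in> A then w - h else h)) =
    (\<Sum>h\<in>H. c h *\<^sub>R h) - (\<Sum>h\<in>A. c h) *\<^sub>R w"
proof -
  have "(\<Sum>h\<in>H. (if h \<in> A then - c h else c h) *\<^sub>R (if h \<in> A then w - h else h)) =
    (\<Sum>h\<in>H. c h *\<^sub>R h - (if h \<in> A then c h *\<^sub>R w else 0))"
    by (rule sum.cong) (auto simp: algebra_simps)
  also have "\<dots> = (\<Sum>h\<in>H. c h *\<^sub>R h) - (\<Sum>h\<in>H. if h \<in> A then c h *\<^sub>R w else 0)"
    by (rule sum_subtractf)
  also have "(\<Sum>h\<in>H. if h \<in> A then c h *\<^sub>R w else 0) = (\<Sum>h\<in>A. c h *\<^sub>R w)"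
    using assms by (simp add: sum.inter_restrict[symmetric] inf.absorb2)
  finally show ?thesis by (simp add: scaleR_sum_left)
qed

lemma free_family_flip:
  fixes w :: "'a::real_vector"
  assumes H: "finite H" "w \<notin> H" "independent (insert w H)" and A: "A \<subseteq> H"
  shows "free_family (insert w H) (\<lambda>h. if h \<in> A then w - h else h)"
proof (rule free_familyI)
  fix u :: "'a \<Rightarrow> real" and i :: 'a
  let ?c = "\<lambda>h. if h \<in> A then - u h else u h"
  let ?k = "u w - (\<Sum>h\<in>A. ?c h)"
  assume s: "(\<Sum>h\<in>insert w H. u h *\<^sub>R (if h \<in> A then w - h else h)) = 0" and i: "i \<in> insert w H"
  have wA: "w \<notin> A" using A H by auto
  have "(\<Sum>h\<in>H. u h *\<^sub>R (if h \<in> A then w - h else h)) =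
    (\<Sum>h\<in>H. (if h \<in> A then - ?c h else ?c h) *\<^sub>R (if h \<in> A then w - h else h))"
    by (rule sum.cong) auto
  also have "\<dots> = (\<Sum>h\<in>H. ?c h *\<^sub>R h) - (\<Sum>h\<in>A. ?c h) *\<^sub>R w"
    by (rule sum_flip_subset[OF H(1) A])
  finally have "?k *\<^sub>R w + (\<Sum>h\<in>H. ?c h *\<^sub>R h) = 0"
    using s H(1,2) wA by (simp add: scaleR_diff_left add_diff_eq diff_add_eq)
  moreover have "(\<Sum>h\<in>H. (if h = w then ?k else ?c h) *\<^sub>R h) = (\<Sum>h\<in>H. ?c h *\<^sub>R h)"
    using H(2) by (intro sum.cong) auto
  ultimately have 0: "(\<Sum>h\<in>insert w H. (if h = w then ?k else ?c h) *\<^sub>R h) = 0"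
    using H(1,2) by simp
  have free: "free_family (insert w H) (\<lambda>x. x)" using free_family_id_iff H by blast
  have z: "(if h = w then ?k else ?c h) = 0" if "h \<in> insert w H" for h
    using free_familyD[OF free 0 that] .
  have zH: "u h = 0" if "h \<in> H" for h using z[of h] that H(2) by (auto split: if_splits)
  moreover have "u w = 0" using z[of w] zH A by (simp add: subset_iff)
  ultimately show "u i = 0" using i by auto
qed

text \<open>If \<open>x = k w + \<Sum> c h\<close>, then flipping a subset \<open>A\<close> of the basis turns the coefficient of \<open>w\<close> into
  \<open>k + \<Sum>A c\<close>, which unimodularity confines to \<open>{-1, 0, 1}\<close>. The same holds for \<open>x - w\<close>, whose
  coefficient is smaller by one. So all these subset sums lie in \<open>{0, 1}\<close>, and this leaves room for a
  single non-zero coefficient \<open>c\<close>.\<close>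

lemma sharing_triangle_basis:
  assumes W: "unimodular_system W" and w: "w \<in> W"
    and H: "finite H" "H \<subseteq> sharing_triangle W w" "w \<notin> H" "independent (insert w H)"
    and x: "x \<in> sharing_triangle W w" "x \<in> span (insert w H)"
  shows "x \<in> H \<or> w - x \<in> H"
proof -
  obtain k c where xc: "x = k *\<^sub>R w + (\<Sum>h\<in>H. c h *\<^sub>R h)"
    using x(2) unfolding span_breakdown_eq span_finite[OF H(1)]
    by (metis (no_types, lifting) add.commute diff_add_cancel rangeE)
  have key: "l + (\<Sum>h\<in>A. c h) \<in> {-1, 0, 1}" "\<And>h. h \<in> H \<Longrightarrow> c h \<in> {-1, 0, 1} \<or> h \<in> A"
    if A: "A \<subseteq> H" and y: "l *\<^sub>R w + (\<Sum>h\<in>H. c h *\<^sub>R h) \<in> W" for A l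
  proof -
    let ?v = "\<lambda>h. if h \<in> A then w - h else h"
    let ?c = "\<lambda>h. if h = w then l + (\<Sum>h\<in>A. c h) else if h \<in> A then - c h else c h"
    have wA: "w \<notin> A" using A H by auto
    have "(\<Sum>h\<in>H. ?c h *\<^sub>R ?v h) =
        (\<Sum>h\<in>H. (if h \<in> A then - c h else c h) *\<^sub>R (if h \<in> A then w - h else h))"
      using H(3) by (intro sum.cong) auto
    also have "\<dots> = (\<Sum>h\<in>H. c h *\<^sub>R h) - (\<Sum>h\<in>A. c h) *\<^sub>R w"
      by (rule sum_flip_subset[OF H(1) A])
    finally have "(\<Sum>h\<in>insert w H. ?c h *\<^sub>R ?v h) \<in> W"
      using y H(1,3) wA by (simp add: algebra_simps)
    moreover have "?v ` insert w H \<subseteq> W"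
      using H(2) w wA unimodular_diff_commute[OF W] by (auto simp: sharing_triangle_def)
    ultimately have *: "?c h \<in> {-1, 0, 1}" if "h \<in> insert w H" for h
      using unimodular_coefficient[OF W _ _ free_family_flip[OF H(1,3,4) A], of ?c h] H(1) that by blast
    from *[of w] show "l + (\<Sum>h\<in>A. c h) \<in> {-1, 0, 1}" by simp
    fix h assume "h \<in> H"
    moreover from this have "h \<noteq> w" using H(3) by auto
    ultimately show "c h \<in> {-1, 0, 1} \<or> h \<in> A" using *[of h] by (cases "h \<in> A") simp_all
  qed
  have xW: "k *\<^sub>R w + (\<Sum>h\<in>H. c h *\<^sub>R h) \<in> W" "(k - 1) *\<^sub>R w + (\<Sum>h\<in>H. c h *\<^sub>R h) \<in> W"
    using x(1) xc by (auto simp: sharing_triangle_def algebra_simps)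
  have c: "c h \<in> {-1, 0, 1}" if "h \<in> H" for h using key(2)[OF _ xW(1), of "{}"] that by auto
  \<comment> \<open>The value -1 is excluded by the coefficient for x - w, the other values by the one for x.\<close>
  have bound: "k + (\<Sum>h\<in>A. c h) \<in> {0, 1}" if "A \<subseteq> H" for A
    using key(1)[OF that xW(1)] key(1)[OF that xW(2)] by auto
  have k: "k \<in> {0, 1}" using bound[of "{}"] by simp
  show ?thesis
  proof (cases "\<exists>h\<in>H. c h \<noteq> 0")
    case False
    then have "x = k *\<^sub>R w" using xc by (simp add: sum.neutral)
    then have False
      using k x(1) unimodular_nonzero[OF W, of x] sharing_triangle_not_multiple[OF W w x(1)]
      by (auto simp: sharing_triangle_def)
    then show ?thesis ..
  next
    case True
    then obtain h where h: "h \<in> H" "c h \<noteq> 0" by blast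
    have other: "c h' = 0" if "h' \<in> H" "h' \<noteq> h" for h'
    proof (rule ccontr)
      assume "c h' \<noteq> 0"
      then show False
        using bound[of "{h}"] bound[of "{h'}"] bound[of "{h, h'}"] k c[OF h(1)] c[OF that(1)] h that
        by auto
    qed
    have "(\<Sum>i\<in>H. c i *\<^sub>R i) = (\<Sum>i\<in>{h}. c i *\<^sub>R i)"
      using h other H(1) by (intro sum.mono_neutral_right) auto
    then have xh: "x = k *\<^sub>R w + c h *\<^sub>R h" using xc by simp
    then show ?thesis using bound[of "{h}"] k c[OF h(1)] h by auto
  qed
qed

text \<open>Basis extension inside the triangles on \<open>w\<close>: the set \<open>H\<close> picks one side from each triangle.\<close>

lemma sharing_triangle_obtain_basis:
  assumes W: "unimodular_system W" and w: "w \<in> W" and n: "rank_at_most W n"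
  obtains H where "finite H" "w \<notin> H" "independent (insert w H)" "card H + 1 \<le> n"
    "sharing_triangle W w = H \<union> (\<lambda>h. w - h) ` H"
proof -
  let ?D = "sharing_triangle W w"
  have "independent {w}" using unimodular_nonzero[OF W w] by simp
  then obtain B where B: "{w} \<subseteq> B" "B \<subseteq> insert w ?D" "independent B" "insert w ?D \<subseteq> span B"
    using maximal_independent_subset_extend[of "{w}" "insert w ?D"] by blast
  have BW: "B \<subseteq> W" using B(2) w by (auto simp: sharing_triangle_def)
  have fin: "finite B" and card: "card B \<le> n" using n BW B(3) by (auto simp: rank_at_most_def)
  define H where "H = B - {w}"
  have BH: "B = insert w H" using B(1) by (auto simp: H_def)
  have H: "finite H" "H \<subseteq> ?D" "w \<notin> H" using fin B(2) by (auto simp: H_def)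
  have ind: "independent (insert w H)" using B(3) unfolding BH .
  have "?D \<subseteq> H \<union> (\<lambda>h. w - h) ` H"
  proof
    fix x assume x: "x \<in> ?D"
    then have "x \<in> H \<or> w - x \<in> H"
      using sharing_triangle_basis[OF W w H ind x] B(4) x unfolding BH by blast
    moreover have "x = w - (w - x)" by simp
    ultimately show "x \<in> H \<union> (\<lambda>h. w - h) ` H" by blast
  qed
  moreover have "H \<union> (\<lambda>h. w - h) ` H \<subseteq> ?D"
    using H(2) sharing_triangle_flip[OF W] by blast
  ultimately show thesis using that[OF H(1,3) ind] card H(1,3) unfolding BH by fastforce
qed

lemma card_sharing_triangle_le:
  assumes W: "unimodular_system W" and w: "w \<in> W" and n: "rank_at_most W n"
  shows "card (sharing_triangle W w) \<le> 2 * (n - 1)"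
proof -
  obtain H where H: "finite H" "card H + 1 \<le> n" "sharing_triangle W w = H \<union> (\<lambda>h. w - h) ` H"
    using sharing_triangle_obtain_basis[OF assms] by metis
  have "card (sharing_triangle W w) \<le> card H + card ((\<lambda>h. w - h) ` H)"
    unfolding H(3) by (rule card_Un_le)
  also have "\<dots> \<le> card H + card H" using card_image_le[OF H(1)] by simp
  finally show ?thesis using H(2) by simp
qed

section \<open>Contraction and the bound\<close>

text \<open>The quotient by the line of \<open>w\<close>, realised inside the same space as the projection along \<open>w\<close>
  onto the kernel of a functional \<open>\<phi>\<close> with \<open>\<phi> w = 1\<close>.\<close>

definition collapse :: "('a::real_vector \<Rightarrow> real) \<Rightarrow> 'a \<Rightarrow> 'a \<Rightarrow> 'a" where
  "collapse \<phi> w x = x - \<phi> x *\<^sub>R w"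

text \<open>The name is that of the corresponding operation on matroids.\<close>

definition contraction :: "('a::real_vector \<Rightarrow> real) \<Rightarrow> 'a \<Rightarrow> 'a set \<Rightarrow> 'a set" where
  "contraction \<phi> w W = collapse \<phi> w ` W - {0}"

lemma linear_collapse: "linear \<phi> \<Longrightarrow> linear (collapse \<phi> w)"
  by (rule linearI) (auto simp: collapse_def linear_add linear_scale algebra_simps)

lemma collapse_self: "\<phi> w = 1 \<Longrightarrow> collapse \<phi> w w = 0"
  by (simp add: collapse_def)

lemma functional_one_exists:
  fixes w :: "'a::real_vector"
  assumes "w \<noteq> 0"
  obtains \<phi> :: "'a \<Rightarrow> real" where "linear \<phi>" "\<phi> w = 1"
proof -
  have "independent {w}" using assms by simp
  then show thesis using linear_independent_extend[of "{w}" "\<lambda>_. 1"] that by auto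
qed

text \<open>Independent vectors of the contraction have preimages that are independent together with \<open>w\<close>. Both
  unimodularity and the drop of the rank under contraction follow from this.\<close>

lemma contraction_free_lift:
  assumes \<phi>: "linear \<phi>" "\<phi> w = 1" and w: "w \<in> W"
    and S: "finite S" "S \<subseteq> contraction \<phi> w W" "independent S"
  obtains v where "w \<notin> S" "v ` insert w S \<subseteq> W" "v w = w" "\<forall>s\<in>S. collapse \<phi> w (v s) = s"
    "free_family (insert w S) v"
proof -
  let ?p = "collapse \<phi> w"
  have lin: "linear ?p" by (rule linear_collapse[OF \<phi>(1)])
  have "\<phi> (?p x) = 0" for x using \<phi> by (simp add: collapse_def linear_diff linear_scale)
  then have wS: "w \<notin> S" using S(2) \<phi>(2)
    unfolding contraction_def by (metis DiffE imageE subsetD zero_neq_one)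
  have "\<forall>s\<in>S. \<exists>x\<in>W. ?p x = s" using S(2) by (auto simp: contraction_def)
  then obtain g where g: "\<forall>s\<in>S. g s \<in> W \<and> ?p (g s) = s" by metis
  let ?v = "g(w := w)"
  have v: "?p (?v s) = s" if "s \<in> S" for s using g that wS by auto
  have "free_family (insert w S) ?v"
  proof (rule free_familyI)
    fix u i assume s: "(\<Sum>i\<in>insert w S. u i *\<^sub>R ?v i) = 0" and i: "i \<in> insert w S"
    have s': "u w *\<^sub>R w + (\<Sum>i\<in>S. u i *\<^sub>R ?v i) = 0" using s S(1) wS by simp
    then have "?p (u w *\<^sub>R w + (\<Sum>i\<in>S. u i *\<^sub>R ?v i)) = 0" using lin linear_0 by metis
    then have "(\<Sum>i\<in>S. u i *\<^sub>R i) = 0"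
      using v by (simp add: linear_add[OF lin] linear_scale[OF lin] linear_sum[OF lin]
          collapse_self[of \<phi>, OF \<phi>(2)] del: fun_upd_apply cong: sum.cong)
    then have "\<forall>i\<in>S. u i = 0" using S free_family_id_iff[OF S(1)] free_familyD by metis
    moreover from this s' have "u w *\<^sub>R w = 0" by (simp add: sum.neutral)
    moreover have "w \<noteq> 0" using \<phi> linear_0 by force
    ultimately show "u i = 0" using i by auto
  qed
  then show thesis using that[of ?v] wS g v w by auto
qed

lemma unimodular_contraction:
  assumes W: "unimodular_system W" and \<phi>: "linear \<phi>" "\<phi> w = 1" and w: "w \<in> W"
  shows "unimodular_system (contraction \<phi> w W)"
proof -
  let ?p = "collapse \<phi> w"
  have lin: "linear ?p" by (rule linear_collapse[OF \<phi>(1)])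
  have "- x \<in> contraction \<phi> w W" if x: "x \<in> contraction \<phi> w W" for x
  proof -
    from x obtain y where "y \<in> W" "x = ?p y" "x \<noteq> 0" by (auto simp: contraction_def)
    then show ?thesis using unimodular_uminus_iff[OF W, of y] linear_neg[OF lin, of y]
      by (auto simp: contraction_def intro!: image_eqI[of _ _ "- y"])
  qed
  moreover have "c b \<in> {-1, 0, 1}"
    if S: "finite S" "S \<subseteq> contraction \<phi> w W" "independent S"
      and x: "(\<Sum>b\<in>S. c b *\<^sub>R b) \<in> contraction \<phi> w W" and b: "b \<in> S" for S c b
  proof -
    obtain v where v: "w \<notin> S" "v ` insert w S \<subseteq> W" "v w = w" "\<forall>s\<in>S. ?p (v s) = s"
      "free_family (insert w S) v"
      using contraction_free_lift[OF \<phi> w S] by metis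
    obtain y where y: "y \<in> W" "(\<Sum>b\<in>S. c b *\<^sub>R b) = ?p y" using x by (auto simp: contraction_def)
    \<comment> \<open>The coefficient of w in the lift of the combination.\<close>
    let ?k = "\<phi> y - \<phi> (\<Sum>b\<in>S. c b *\<^sub>R v b)"
    have "?p y = ?p (\<Sum>b\<in>S. c b *\<^sub>R v b)"
      using v(4) y(2) by (simp add: linear_scale[OF lin] linear_sum[OF lin])
    then have "y = ?k *\<^sub>R w + (\<Sum>b\<in>S. c b *\<^sub>R v b)"
      by (simp add: collapse_def algebra_simps)
    also have "\<dots> = (\<Sum>b\<in>insert w S. (c(w := ?k)) b *\<^sub>R v b)"
    proof -
      have "(\<Sum>b\<in>S. (c(w := ?k)) b *\<^sub>R v b) = (\<Sum>b\<in>S. c b *\<^sub>R v b)"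
        using v(1) by (intro sum.cong) auto
      then show ?thesis using v(1,3) S(1) by simp
    qed
    finally have "(c(w := ?k)) b \<in> {-1, 0, 1}"
      using unimodular_coefficient[OF W _ v(2,5), of "c(w := ?k)" b] S(1) y(1) b by simp
    then show ?thesis using v(1) b by (auto split: if_splits)
  qed
  ultimately show ?thesis unfolding unimodular_system_def by (auto simp: contraction_def)
qed

lemma rank_contraction:
  assumes n: "rank_at_most W n" and \<phi>: "linear \<phi>" "\<phi> w = 1" and w: "w \<in> W"
  shows "rank_at_most (contraction \<phi> w W) (n - 1)"
proof -
  have *: "card S \<le> n - 1"
    if S: "finite S" "S \<subseteq> contraction \<phi> w W" "independent S" for S
  proof -
    obtain v where v: "w \<notin> S" "v ` insert w S \<subseteq> W" "free_family (insert w S) v"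
      using contraction_free_lift[OF \<phi> w S] by metis
    then have "card (insert w S) \<le> n" using rank_at_most_card[OF n _ v(2,3)] S(1) by simp
    then show ?thesis using v(1) S(1) by simp
  qed
  have "finite S \<and> card S \<le> n - 1" if S: "S \<subseteq> contraction \<phi> w W" "independent S" for S
  proof -
    have "finite S"
    proof (rule ccontr)
      assume "infinite S"
      then obtain T where T: "T \<subseteq> S" "finite T" "card T = n"
        using infinite_arbitrarily_large by blast
      then have "n \<le> n - 1" using * S independent_mono by blast
      moreover have "n \<ge> 1"
        using rank_at_most_card[OF n, of "{w}" "\<lambda>x. x"] w \<phi> linear_0[OF \<phi>(1)]
        by (force simp: free_family_def)
      ultimately show False by simp
    qed
    then show ?thesis using * S by blast
  qed
  then show ?thesis unfolding rank_at_most_def by blast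
qed

lemma contraction_fibre:
  assumes W: "unimodular_system W" and \<phi>: "linear \<phi>" "\<phi> w = 1" and w: "w \<in> W"
    and x: "x \<in> W" "x \<noteq> w" "x \<noteq> - w" and y: "y \<in> W" and xy: "collapse \<phi> w x = collapse \<phi> w y"
  shows "y = x \<or> y = x + w \<or> y = x - w"
proof -
  have y_eq: "y = 1 *\<^sub>R x + (\<phi> y - \<phi> x) *\<^sub>R w" using xy by (simp add: collapse_def algebra_simps)
  then have "\<phi> y - \<phi> x \<in> {-1, 0, 1}" using unimodular_two(2)[OF W w x] y by metis
  then show ?thesis using y_eq by auto
qed

lemma collapse_eq_0_iff:
  assumes W: "unimodular_system W" and \<phi>: "linear \<phi>" "\<phi> w = 1" and w: "w \<in> W" and x: "x \<in> W"
  shows "collapse \<phi> w x = 0 \<longleftrightarrow> x = w \<or> x = - w"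
proof
  assume "collapse \<phi> w x = 0"
  then have "x = \<phi> x *\<^sub>R w" by (simp add: collapse_def)
  then show "x = w \<or> x = - w"
    using unimodular_multiple[OF W w, of "\<phi> x"] x by (metis scaleR_minus1_left scaleR_one)
qed (use \<phi> in \<open>auto simp: collapse_def linear_neg\<close>)

text \<open>Each fibre of the projection has one or two elements, and a fibre with two elements has the form
  \<open>{u, u - w}\<close>. Removing the elements \<open>u\<close> of all these pairs therefore makes the projection
  injective without changing its image.\<close>

lemma card_eq_contraction:
  assumes W: "unimodular_system W" "finite W" and \<phi>: "linear \<phi>" "\<phi> w = 1" and w: "w \<in> W"
  shows "card W = 2 + card (sharing_triangle W w) + card (contraction \<phi> w W)"
proof -
  let ?p = "collapse \<phi> w" and ?D = "sharing_triangle W w"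
  let ?R = "W - {w, - w} - ?D"
  have two: "w \<noteq> - w" using unimodular_nonzero[OF W(1) w]
    by (metis add.right_inverse scaleR_2 scaleR_eq_0_iff zero_neq_numeral)
  have D: "?D \<subseteq> W - {w, - w}"
    using sharing_triangle_not_multiple[OF W(1) w] by (auto simp: sharing_triangle_def)
  have "inj_on ?p ?R"
  proof (rule inj_onI)
    fix x y assume x: "x \<in> ?R" and y: "y \<in> ?R" and "?p x = ?p y"
    then have "y = x \<or> y = x + w \<or> y = x - w"
      using contraction_fibre[OF W(1) \<phi> w, of x y] by blast
    then show "x = y" using x y by (auto simp: sharing_triangle_def)
  qed
  then have "card (?p ` ?R) = card ?R" by (rule card_image)
  moreover have "?p ` ?R = contraction \<phi> w W"
  proof
    show "?p ` ?R \<subseteq> contraction \<phi> w W"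
      using collapse_eq_0_iff[OF W(1) \<phi> w] by (auto simp: contraction_def)
    show "contraction \<phi> w W \<subseteq> ?p ` ?R"
    proof
      fix y assume "y \<in> contraction \<phi> w W"
      then obtain x where x: "x \<in> W" "y = ?p x" "y \<noteq> 0" by (auto simp: contraction_def)
      then have x': "x \<noteq> w" "x \<noteq> - w" using collapse_eq_0_iff[OF W(1) \<phi> w] by auto
      show "y \<in> ?p ` ?R"
      proof (cases "x \<in> ?D")
        case False
        then show ?thesis using x x' by blast
      next
        case True
        have "x - w \<notin> ?D"
        proof
          assume "x - w \<in> ?D"
          then have "1 *\<^sub>R x + (- 2) *\<^sub>R w \<in> W"
            by (simp add: sharing_triangle_def scaleR_2 algebra_simps)
          then show False using unimodular_two(2)[OF W(1) w x(1) x'] by fastforce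
        qed
        moreover have "x - w \<in> W" using True by (simp add: sharing_triangle_def)
        moreover have "?p (x - w) = y"
          using x(2) \<phi> by (simp add: collapse_def linear_diff algebra_simps)
        moreover from this x(3) have "x - w \<noteq> w" "x - w \<noteq> - w"
          using collapse_eq_0_iff[OF W(1) \<phi> w] \<open>x - w \<in> W\<close> by auto
        ultimately show ?thesis by blast
      qed
    qed
  qed
  moreover have "card W = card {w, - w} + card ?D + card ?R"
  proof -
    have "card (W - {w, - w}) = card ?D + card ?R"
      using D W(2) by (metis card_Diff_subset card_mono finite_Diff finite_subset le_add_diff_inverse)
    moreover have "card W = card {w, - w} + card (W - {w, - w})"
      using w W unimodular_uminus_iff[OF W(1)]
      by (metis card_Diff_subset card_mono empty_subsetI finite.emptyI finite_insert insert_subset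
          le_add_diff_inverse)
    ultimately show ?thesis by simp
  qed
  ultimately show ?thesis using two by simp
qed

lemma card_unimodular_le:
  assumes "unimodular_system W" "rank_at_most W n"
  shows "card W \<le> n * (n + 1)"
  using assms
proof (induction n arbitrary: W)
  case 0
  have "W = {}"
  proof (rule ccontr)
    assume "W \<noteq> {}"
    then obtain w where "w \<in> W" by blast
    then show False
      using 0 unimodular_nonzero[OF 0(1)] rank_at_most_card[OF 0(2), of "{w}" "\<lambda>x. x"]
      by (auto simp: free_family_def)
  qed
  then show ?case by simp
next
  case (Suc n)
  show ?case
  proof (cases "W = {}")
    case False
    then obtain w where w: "w \<in> W" by blast
    obtain \<phi> :: "'a \<Rightarrow> real" where \<phi>: "linear \<phi>" "\<phi> w = 1"
      using functional_one_exists[OF unimodular_nonzero[OF Suc(2) w]] by metis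
    have "card (contraction \<phi> w W) \<le> n * (n + 1)"
      using Suc(1)[OF unimodular_contraction[OF Suc(2) \<phi> w]] rank_contraction[OF Suc(3) \<phi> w] by simp
    moreover have "card (sharing_triangle W w) \<le> 2 * n"
      using card_sharing_triangle_le[OF Suc(2) w Suc(3)] by simp
    moreover have "card W = 2 + card (sharing_triangle W w) + card (contraction \<phi> w W)"
      using card_eq_contraction[OF Suc(2) unimodular_finite[OF Suc(2,3)] \<phi> w] .
    ultimately show ?thesis by (simp add: algebra_simps)
  qed simp
qed

section \<open>Systems of maximal size\<close>

lemma free_family_subset:
  assumes "finite I" "free_family I v" "J \<subseteq> I"
  shows "free_family J v"
proof (rule free_familyI)
  fix u i assume s: "(\<Sum>i\<in>J. u i *\<^sub>R v i) = 0" and i: "i \<in> J"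
  have "(\<Sum>i\<in>I. (if i \<in> J then u i else 0) *\<^sub>R v i) = (\<Sum>i\<in>J. u i *\<^sub>R v i)"
    using assms by (intro sum.mono_neutral_cong_right) auto
  then show "u i = 0"
    using free_familyD[OF assms(2), of "\<lambda>i. if i \<in> J then u i else 0" i] s i assms(3) by auto
qed

lemma free_family_three:
  assumes "finite I" "free_family I v" "{i, j, k} \<subseteq> I" "i \<noteq> j" "i \<noteq> k" "j \<noteq> k"
    and 0: "a *\<^sub>R v i + b *\<^sub>R v j + c *\<^sub>R v k = 0"
  shows "a = 0 \<and> b = 0 \<and> c = 0"
proof -
  let ?u = "\<lambda>l. if l = i then a else if l = j then b else c"
  have "(\<Sum>l\<in>{i, j, k}. ?u l *\<^sub>R v l) = 0" using assms(4-6) 0 by (simp add: add.assoc)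
  note z = free_familyD[OF free_family_subset[OF assms(1-3)] this]
  show ?thesis using z[of i] z[of j] z[of k] assms(4-6) by auto
qed

lemma free_family_four:
  assumes "finite I" "free_family I v" "{i, j, k, l} \<subseteq> I" "i \<noteq> j" "i \<noteq> k" "j \<noteq> k"
    "i \<noteq> l" "j \<noteq> l" "k \<noteq> l"
    and 0: "a *\<^sub>R v i + b *\<^sub>R v j + c *\<^sub>R v k + d *\<^sub>R v l = 0"
  shows "a = 0 \<and> b = 0 \<and> c = 0 \<and> d = 0"
proof -
  let ?u = "\<lambda>m. if m = i then a else if m = j then b else if m = k then c else d"
  have "(\<Sum>m\<in>{i, j, k, l}. ?u m *\<^sub>R v m) = 0" using assms(4-9) 0 by (simp add: add.assoc)
  note z = free_familyD[OF free_family_subset[OF assms(1-3)] this]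
  show ?thesis using z[of i] z[of j] z[of k] z[of l] assms(4-9) by auto
qed

text \<open>Otherwise \<open>u\<close> would be half the sum of the independent members \<open>u - v\<close>, \<open>u + v - w\<close> and \<open>w\<close>.\<close>

lemma difference_excludes_sum:
  assumes W: "unimodular_system W" and in_W: "u \<in> W" "w \<in> W" "u - v \<in> W" "u + v - w \<in> W"
    and free: "\<And>a b c. a *\<^sub>R u + b *\<^sub>R v + c *\<^sub>R w = 0 \<Longrightarrow> a = 0 \<and> b = 0 \<and> c = 0"
  shows False
proof -
  let ?v = "\<lambda>i::nat. [u - v, u + v - w, w] ! i"
  have "free_family {..<3} ?v"
  proof (rule free_familyI)
    fix f :: "nat \<Rightarrow> real" and i assume "(\<Sum>i<3. f i *\<^sub>R ?v i) = 0" and i: "i \<in> {..<3::nat}"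
    then have "(f 0 + f 1) *\<^sub>R u + (f 1 - f 0) *\<^sub>R v + (f 2 - f 1) *\<^sub>R w = 0"
      by (simp add: numeral_3_eq_3 numeral_2_eq_2 algebra_simps)
    from free[OF this] have "f 0 = 0" "f 1 = 0" "f 2 = 0" by auto
    moreover have "i = 0 \<or> i = 1 \<or> i = 2" using i by auto
    ultimately show "f i = 0" by auto
  qed
  moreover have "(\<Sum>i<3. (1 / 2) *\<^sub>R ?v i) \<in> W"
  proof -
    have "(\<Sum>i<3. (1 / 2) *\<^sub>R ?v i) = (1 / 2 + 1 / 2) *\<^sub>R u"
      unfolding scaleR_left_distrib by (simp add: numeral_3_eq_3 algebra_simps)
    then show ?thesis using in_W by simp
  qed
  moreover have "?v ` {..<3} \<subseteq> W" using in_W by (auto simp: less_Suc_eq numeral_3_eq_3)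
  ultimately have "(1 / 2 :: real) \<in> {-1, 0, 1}"
    using unimodular_coefficient[OF W, of "{..<3::nat}" ?v "\<lambda>_. 1 / 2" 0] by simp
  then show False by simp
qed

text \<open>Otherwise \<open>a\<close> would be half the sum of the independent members \<open>a - u\<close>, \<open>a - v\<close>,
  \<open>u + v - w\<close> and \<open>w\<close>.\<close>

lemma differences_exclude_sum:
  assumes W: "unimodular_system W"
    and in_W: "a \<in> W" "w \<in> W" "a - u \<in> W" "a - v \<in> W" "u + v - w \<in> W"
    and free: "\<And>k l m n. k *\<^sub>R a + l *\<^sub>R u + m *\<^sub>R v + n *\<^sub>R w = 0 \<Longrightarrow>
      k = 0 \<and> l = 0 \<and> m = 0 \<and> n = 0"
  shows False
proof -
  let ?v = "\<lambda>i::nat. [a - u, a - v, u + v - w, w] ! i"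
  have "free_family {..<4} ?v"
  proof (rule free_familyI)
    fix f :: "nat \<Rightarrow> real" and i assume "(\<Sum>i<4. f i *\<^sub>R ?v i) = 0" and i: "i \<in> {..<4::nat}"
    then have "(f 0 + f 1) *\<^sub>R a + (f 2 - f 0) *\<^sub>R u + (f 2 - f 1) *\<^sub>R v + (f 3 - f 2) *\<^sub>R w = 0"
      by (simp add: eval_nat_numeral algebra_simps)
    from free[OF this] have "f 0 = 0" "f 1 = 0" "f 2 = 0" "f 3 = 0" by auto
    moreover have "i = 0 \<or> i = 1 \<or> i = 2 \<or> i = 3" using i by auto
    ultimately show "f i = 0" by auto
  qed
  moreover have "(\<Sum>i<4. (1 / 2) *\<^sub>R ?v i) \<in> W"
  proof -
    have "(\<Sum>i<4. (1 / 2) *\<^sub>R ?v i) = (1 / 2 + 1 / 2) *\<^sub>R a"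
      unfolding scaleR_left_distrib by (simp add: eval_nat_numeral algebra_simps)
    then show ?thesis using in_W by simp
  qed
  moreover have "?v ` {..<4} \<subseteq> W" using in_W by (auto simp: less_Suc_eq eval_nat_numeral)
  ultimately have "(1 / 2 :: real) \<in> {-1, 0, 1}"
    using unimodular_coefficient[OF W, of "{..<4::nat}" ?v "\<lambda>_. 1 / 2" 0] by simp
  then show False by simp
qed

lemma rank_positive:
  assumes W: "unimodular_system W" and n: "rank_at_most W n" and w: "w \<in> W"
  shows "n \<ge> 1"
  using rank_at_most_card[OF n, of "{w}" "\<lambda>x. x"] w unimodular_nonzero[OF W w]
  by (auto simp: free_family_def)

text \<open>The two bounds that enter \<open>card_unimodular_le\<close> add up to \<open>n (n + 1)\<close>, so both must be sharp.\<close>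

lemma extremal_card_sharing_triangle:
  assumes W: "unimodular_system W" and n: "rank_at_most W n" and card: "card W = n * (n + 1)"
    and w: "w \<in> W"
  shows "card (sharing_triangle W w) = 2 * (n - 1)"
proof -
  obtain \<phi> :: "'a \<Rightarrow> real" where \<phi>: "linear \<phi>" "\<phi> w = 1"
    using functional_one_exists[OF unimodular_nonzero[OF W w]] by metis
  obtain m where m: "n = Suc m" using rank_positive[OF W n w] by (cases n) auto
  have "card (contraction \<phi> w W) \<le> m * (m + 1)"
    using card_unimodular_le[OF unimodular_contraction[OF W \<phi> w] rank_contraction[OF n \<phi> w]] m
    by simp
  moreover have "card (sharing_triangle W w) \<le> 2 * m"
    using card_sharing_triangle_le[OF W w n] m by simp
  moreover have "card W = 2 + card (sharing_triangle W w) + card (contraction \<phi> w W)"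
    using card_eq_contraction[OF W unimodular_finite[OF W n] \<phi> w] .
  ultimately show ?thesis using card m by (simp add: algebra_simps)
qed

text \<open>Contracting \<open>x\<close> maps the \<open>2 (n - 1)\<close> elements of the triangles on \<open>w\<close> into a set with at most
  \<open>2 (n - 2)\<close> elements, because none of these triangles contains \<open>x\<close>. Two of the elements must coincide modulo \<open>x\<close>.\<close>

lemma extremal_difference:
  assumes W: "unimodular_system W" and n: "rank_at_most W n" and card: "card W = n * (n + 1)"
    and w: "w \<in> W" and x: "x \<in> W" "x \<noteq> w" "x \<noteq> - w"
    and xD: "x \<notin> sharing_triangle W w" "- x \<notin> sharing_triangle W w"
  shows "\<exists>u \<in> sharing_triangle W w. \<exists>v \<in> sharing_triangle W w. x = u - v"
proof -
  let ?D = "sharing_triangle W w"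
  obtain \<phi> :: "'a \<Rightarrow> real" where \<phi>: "linear \<phi>" "\<phi> x = 1"
    using functional_one_exists[OF unimodular_nonzero[OF W x(1)]] by metis
  let ?q = "collapse \<phi> x" and ?W = "contraction \<phi> x W"
  have lin: "linear ?q" by (rule linear_collapse[OF \<phi>(1)])
  have W': "unimodular_system ?W" by (rule unimodular_contraction[OF W \<phi> x(1)])
  have n': "rank_at_most ?W (n - 1)" by (rule rank_contraction[OF n \<phi> x(1)])
  have q: "?q y \<in> ?W" if "y \<in> W" "y \<noteq> x" "y \<noteq> - x" for y
    using collapse_eq_0_iff[OF W \<phi> x(1)] that by (auto simp: contraction_def)
  have qw: "?q w \<in> ?W" using q[OF w] x by (metis minus_minus)
  have "?q ` ?D \<subseteq> sharing_triangle ?W (?q w)"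
  proof
    fix y assume "y \<in> ?q ` ?D"
    then obtain u where u: "u \<in> ?D" "y = ?q u" by blast
    have "w - u \<in> ?D" by (rule sharing_triangle_flip[OF W u(1)])
    then have "w - u \<noteq> x" "w - u \<noteq> - x" "u \<noteq> x" "u \<noteq> - x" using u(1) xD by auto
    moreover from this have "u - w \<noteq> x" "u - w \<noteq> - x" by (auto simp: algebra_simps)
    ultimately show "y \<in> sharing_triangle ?W (?q w)"
      using u q[of u] q[of "u - w"] by (simp add: sharing_triangle_def linear_diff[OF lin])
  qed
  then have "card (?q ` ?D) \<le> card (sharing_triangle ?W (?q w))"
    by (rule card_mono[rotated]) (use unimodular_finite[OF W' n'] in \<open>simp add: sharing_triangle_def\<close>)
  also have "\<dots> \<le> 2 * (n - 1 - 1)" by (rule card_sharing_triangle_le[OF W' qw n'])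
  also have "\<dots> < 2 * (n - 1)" using rank_positive[OF W' n' qw] by simp
  also have "\<dots> = card ?D" using extremal_card_sharing_triangle[OF W n card w] by simp
  finally have "\<not> inj_on ?q ?D" using card_image by fastforce
  then obtain u v where uv: "u \<in> ?D" "v \<in> ?D" "?q u = ?q v" "u \<noteq> v" by (auto simp: inj_on_def)
  have "v = u \<or> v = u + x \<or> v = u - x"
    using contraction_fibre[OF W \<phi> x(1), of u v] uv xD by (auto simp: sharing_triangle_def)
  then have "x = v - u \<or> x = u - v" using uv(4) by auto
  then show ?thesis using uv by blast
qed

lemma card_triangle_pair_le:
  assumes W: "unimodular_system W" and w: "w \<in> W" and u: "u \<in> W"
    and free: "\<And>a b c. a *\<^sub>R u + b *\<^sub>R v + c *\<^sub>R w = 0 \<Longrightarrow> a = 0 \<and> b = 0 \<and> c = 0"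
  shows "card (W \<inter> {u - v, v - u, u + v - w, w - u - v}) \<le> 2"
proof (cases "u - v \<in> W")
  case True
  then have "u + v - w \<notin> W" using difference_excludes_sum[OF W u w _ _ free] by blast
  then have "W \<inter> {u - v, v - u, u + v - w, w - u - v} \<subseteq> {u - v, v - u}"
    using unimodular_diff_commute[OF W, of "u + v" w] by (auto simp: algebra_simps)
  then have "card (W \<inter> {u - v, v - u, u + v - w, w - u - v}) \<le> card {u - v, v - u}"
    by (intro card_mono) auto
  then show ?thesis by (simp add: card_insert_if split: if_splits)
next
  case False
  then have "W \<inter> {u - v, v - u, u + v - w, w - u - v} \<subseteq> {u + v - w, w - u - v}"
    using unimodular_diff_commute[OF W, of u v] by auto
  then have "card (W \<inter> {u - v, v - u, u + v - w, w - u - v}) \<le> card {u + v - w, w - u - v}"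
    by (intro card_mono) auto
  then show ?thesis by (simp add: card_insert_if split: if_splits)
qed


text \<open>Writing both elements of \<open>extremal_difference\<close> in terms of \<open>H\<close> gives these three shapes; equal
  indices would give the vector zero or the coefficient \<open>2\<close>.\<close>

lemma extremal_other_form:
  assumes W: "unimodular_system W" and n: "rank_at_most W n" and card: "card W = n * (n + 1)"
    and w: "w \<in> W" and H: "sharing_triangle W w = H \<union> (\<lambda>h. w - h) ` H"
    and x: "x \<in> W - ({w, - w} \<union> sharing_triangle W w \<union> uminus ` sharing_triangle W w)"
  shows "\<exists>h\<in>H. \<exists>k\<in>H. h \<noteq> k \<and> x \<in> {h - k, h + k - w, w - h - k}"
proof -
  have HW: "h \<in> W" "h \<noteq> w" "h \<noteq> - w" if "h \<in> H" for h
    using that sharing_triangle_not_multiple[OF W w, of h] H by (auto simp: sharing_triangle_def)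
  have no_double: "h + h - w \<notin> W" "w - h - h \<notin> W" if "h \<in> H" for h
  proof -
    have "2 *\<^sub>R h + (- 1) *\<^sub>R w \<notin> W" using unimodular_two(1)[OF W w HW[OF that]] by fastforce
    then show "h + h - w \<notin> W" by (simp add: scaleR_2)
    then show "w - h - h \<notin> W" using unimodular_diff_commute[OF W, of "h + h" w]
      by (simp add: algebra_simps)
  qed
  have "- x \<notin> sharing_triangle W w" using x by (metis DiffE UnCI image_eqI minus_minus)
  then obtain u v where uv: "u \<in> sharing_triangle W w" "v \<in> sharing_triangle W w" "x = u - v"
    using extremal_difference[OF W n card w, of x] x by auto
  have x0: "x \<in> W" "x \<noteq> 0" using x unimodular_nonzero[OF W] by auto
  from uv(1,2) H consider h k where "h \<in> H" "k \<in> H" "u = h" "v = k"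
    | h k where "h \<in> H" "k \<in> H" "u = h" "v = w - k"
    | h k where "h \<in> H" "k \<in> H" "u = w - h" "v = k"
    | h k where "h \<in> H" "k \<in> H" "u = w - h" "v = w - k"
    by auto
  then show ?thesis
  proof cases
    case 1
    then have "x = h - k" using uv(3) by simp
    moreover from this have "h \<noteq> k" using x0(2) by auto
    ultimately show ?thesis using 1(1,2) by blast
  next
    case 2
    then have "x = h + k - w" using uv(3) by simp
    moreover from this have "h \<noteq> k" using x0(1) no_double[OF 2(1)] by auto
    ultimately show ?thesis using 2(1,2) by blast
  next
    case 3
    then have "x = w - h - k" using uv(3) by simp
    moreover from this have "h \<noteq> k" using x0(1) no_double[OF 3(1)] by auto
    ultimately show ?thesis using 3(1,2) by blast
  next
    case 4
    then have "x = k - h" using uv(3) by simp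
    moreover from this have "k \<noteq> h" using x0(2) by auto
    ultimately show ?thesis using 4(1,2) by blast
  qed
qed

text \<open>There are at least \<open>(n - 1) (n - 2)\<close> members outside the triangles on \<open>w\<close>. Each pair from \<open>H\<close>, which
  has \<open>n - 1\<close> elements, accounts for at most two of them, so no pair can be missed.\<close>

lemma extremal_pair:
  assumes W: "unimodular_system W" and n: "rank_at_most W n" and card: "card W = n * (n + 1)"
    and w: "w \<in> W" and H: "finite H" "w \<notin> H" "independent (insert w H)" "card H + 1 \<le> n"
      "sharing_triangle W w = H \<union> (\<lambda>h. w - h) ` H"
    and hk: "h \<in> H" "k \<in> H" "h \<noteq> k"
  shows "h - k \<in> W \<or> h + k - w \<in> W"
proof (rule ccontr)
  assume no: "\<not> ?thesis"
  let ?D = "sharing_triangle W w"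
  let ?O = "W - ({w, - w} \<union> ?D \<union> uminus ` ?D)"
  let ?T = "\<lambda>P. W \<inter> {x. \<exists>h k. P = {h, k} \<and> h \<noteq> k \<and> x \<in> {h - k, h + k - w, w - h - k}}"
  let ?Ps = "{P. P \<subseteq> H \<and> card P = 2}"
  have fin: "finite W" by (rule unimodular_finite[OF W n])
  have finP: "finite ?Ps" using H(1) by simp
  have HW: "h \<in> W" if "h \<in> H" for h using that H(5) by (auto simp: sharing_triangle_def)
  have free: "free_family (insert w H) (\<lambda>x. x)" using free_family_id_iff H by blast
  have T_pair: "?T {a, b} = W \<inter> {a - b, b - a, a + b - w, w - a - b}" if "a \<noteq> b" for a b
  proof -
    have "(\<exists>h k. {a, b} = {h, k} \<and> h \<noteq> k \<and> Q h k) \<longleftrightarrow> Q a b \<or> Q b a" for Q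
      using that by (auto simp: doubleton_eq_iff)
    then have "?T {a, b} = W \<inter> {x. x \<in> {a - b, a + b - w, w - a - b} \<or> x \<in> {b - a, b + a - w, w - b - a}}"
      by presburger
    moreover have "b + a - w = a + b - w" "w - b - a = w - a - b" by (simp_all add: algebra_simps)
    ultimately show ?thesis by auto
  qed
  have T_le: "card (?T P) \<le> 2" if P: "P \<in> ?Ps" for P
  proof -
    obtain a b where ab: "P = {a, b}" "a \<noteq> b" using P by (auto simp: card_2_iff)
    then have "p = 0 \<and> q = 0 \<and> r = 0" if "p *\<^sub>R a + q *\<^sub>R b + r *\<^sub>R w = 0" for p q r
      using free_family_three[OF _ free, of a b w p q r] P H(1,2) that by auto
    then show ?thesis unfolding ab(1) T_pair[OF ab(2)]
      using card_triangle_pair_le[OF W w HW, of a b] P ab by blast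
  qed
  have "h + k - w \<notin> W" "w - h - k \<notin> W" "h - k \<notin> W" "k - h \<notin> W"
    using no unimodular_diff_commute[OF W, of h k] unimodular_diff_commute[OF W, of "h + k" w]
    by (auto simp: algebra_simps)
  then have T0: "?T {h, k} = {}" unfolding T_pair[OF hk(3)] by blast
  have hkP: "{h, k} \<in> ?Ps" using hk by simp
  have "?O \<subseteq> (\<Union>P\<in>?Ps. ?T P)"
  proof
    fix x assume x: "x \<in> ?O"
    then obtain a b where ab: "a \<in> H" "b \<in> H" "a \<noteq> b" "x \<in> {a - b, a + b - w, w - a - b}"
      using extremal_other_form[OF W n card w H(5)] by metis
    then have "{a, b} \<in> ?Ps" "x \<in> ?T {a, b}" using x by auto
    then show "x \<in> (\<Union>P\<in>?Ps. ?T P)" by blast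
  qed
  then have "card ?O \<le> card (\<Union>P\<in>?Ps. ?T P)"
    using finP fin by (intro card_mono) auto
  also have "\<dots> \<le> (\<Sum>P\<in>?Ps. card (?T P))" by (rule card_UN_le[OF finP])
  also have "\<dots> = card (?T {h, k}) + (\<Sum>P\<in>?Ps - {{h, k}}. card (?T P))"
    by (rule sum.remove[OF finP hkP])
  also have "\<dots> = (\<Sum>P\<in>?Ps - {{h, k}}. card (?T P))" unfolding T0 by simp
  also have "\<dots> \<le> (\<Sum>P\<in>?Ps - {{h, k}}. 2)" using T_le by (intro sum_mono) blast
  also have "\<dots> = 2 * (card ?Ps - 1)" using finP hkP by simp
  also have "card ?Ps = card H choose 2" by (rule n_subsets[OF H(1)])
  also have "2 * ((card H choose 2) - 1) < card H * (card H - 1)"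
  proof -
    have "card H \<ge> 2" using card_mono[OF H(1), of "{h, k}"] hk by simp
    then have "card H * (card H - 1) > 0" by simp
    moreover have "2 * (card H choose 2) = card H * (card H - 1)"
    proof -
      have "even (card H * (card H - 1))" by (cases "even (card H)") auto
      then show ?thesis unfolding choose_two by (rule dvd_mult_div_cancel)
    qed
    ultimately show ?thesis by linarith
  qed
  also have "\<dots> \<le> card ?O"
  proof -
    have "card ({w, - w} \<union> ?D \<union> uminus ` ?D) \<le> 2 + card ?D + card ?D"
    proof -
      have "finite ?D" using fin by (simp add: sharing_triangle_def)
      then have "card (uminus ` ?D) \<le> card ?D" by (rule card_image_le)
      moreover have "card {w, - w} \<le> 2" by (simp add: card_insert_if)
      moreover have "card ({w, - w} \<union> ?D \<union> uminus ` ?D) \<le> card {w, - w} + card ?D + card (uminus ` ?D)"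
        by (meson add_le_mono1 card_Un_le le_trans)
      ultimately show ?thesis by linarith
    qed
    also have "card ?D = 2 * (n - 1)" by (rule extremal_card_sharing_triangle[OF W n card w])
    finally have 1: "card ({w, - w} \<union> ?D \<union> uminus ` ?D) \<le> 2 + 4 * (n - 1)" by simp
    have 2: "card W - card ({w, - w} \<union> ?D \<union> uminus ` ?D) \<le> card ?O"
      using fin by (intro diff_card_le_card_Diff) (simp add: sharing_triangle_def)
    obtain m where m: "n = Suc m" "card H \<le> m" using H(4) by (cases n) auto
    have "card H * (card H - 1) \<le> m * (m - 1)" using m(2) by (intro mult_le_mono) auto
    also have "\<dots> = n * (n + 1) - (2 + 4 * (n - 1))"
      unfolding m(1) by (cases m) (simp_all add: algebra_simps)
    finally show ?thesis using 1 2 card by linarith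
  qed
  finally show False by simp
qed

text \<open>Fix one element \<open>z\<close> of \<open>H\<close> and replace any other \<open>h\<close> by \<open>w - h\<close> if this is needed to bring its
  difference from \<open>z\<close> into \<open>W\<close>. By \<open>differences_exclude_sum\<close> with \<open>a = z\<close>, all other differences then lie
  in \<open>W\<close> as well.\<close>

lemma extremal_clique:
  assumes W: "unimodular_system W" and n: "rank_at_most W n" and card: "card W = n * (n + 1)"
    and w: "w \<in> W"
  obtains G where "finite G" "w \<notin> G" "independent (insert w G)" "card G + 1 = n"
    "sharing_triangle W w = G \<union> (\<lambda>g. w - g) ` G" "\<And>a b. a \<in> G \<Longrightarrow> b \<in> G \<Longrightarrow> a \<noteq> b \<Longrightarrow> a - b \<in> W"
proof -
  obtain H where H: "finite H" "w \<notin> H" "independent (insert w H)" "card H + 1 \<le> n"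
      "sharing_triangle W w = H \<union> (\<lambda>h. w - h) ` H"
    using sharing_triangle_obtain_basis[OF W w n] by metis
  note pair = extremal_pair[OF W n card w H]
  \<comment> \<open>If H is empty, nothing depends on the arbitrary value of z.\<close>
  define z where "z = (SOME h. h \<in> H)"
  define A where "A = {h \<in> H. h \<noteq> z \<and> h - z \<notin> W}"
  define g where "g = (\<lambda>h. if h \<in> A then w - h else h)"
  have A: "A \<subseteq> H" and wA: "w \<notin> A" and zA: "z \<notin> A" using H(2) by (auto simp: A_def)
  have free: "free_family (insert w H) g" unfolding g_def by (rule free_family_flip[OF H(1-3) A])
  have gw: "g w = w" and gz: "g z = z" using wA zA by (simp_all add: g_def)
  have gW: "g h \<in> W" if "h \<in> H" for h
    using that H(5) sharing_triangle_flip[OF W, of h w] by (auto simp: g_def sharing_triangle_def)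
  have inj: "inj_on g (insert w H)" using free_family_inj_on[OF _ free] H(1) by simp
  have dir: "g h - g z \<in> W" if "h \<in> H" "h \<noteq> z" "z \<in> H" for h
    using pair[OF that(1,3,2)] unimodular_diff_commute[OF W, of "h + z" w] that
    by (auto simp: gz g_def A_def algebra_simps)
  have diff: "g h - g k \<in> W" if hk: "h \<in> H" "k \<in> H" "h \<noteq> k" for h k
  proof (rule ccontr)
    assume no: "g h - g k \<notin> W"
    have zH: "z \<in> H" unfolding z_def using someI[of "\<lambda>h. h \<in> H"] hk(1) by blast
    have ho: "h \<noteq> z" and ko: "k \<noteq> z"
      using no dir[of h] dir[of k] hk zH unimodular_diff_commute[OF W, of "g k" "g z"] by auto
    have "g h + g k - w \<in> W"
      using no pair[OF hk] unimodular_diff_commute[OF W, of h k]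
        unimodular_diff_commute[OF W, of "h + k" w]
      by (auto simp: g_def algebra_simps split: if_splits)
    moreover have "g z - g h \<in> W" "g z - g k \<in> W"
      using dir[OF hk(1) ho zH] dir[OF hk(2) ko zH] unimodular_diff_commute[OF W] by auto
    moreover have "p = 0 \<and> q = 0 \<and> r = 0 \<and> s = 0"
      if "p *\<^sub>R g z + q *\<^sub>R g h + r *\<^sub>R g k + s *\<^sub>R w = 0" for p q r s
      using free_family_four[OF _ free, of z h k w p q r s] that H(1,2) hk zH ho ko gw by auto
    ultimately show False using differences_exclude_sum[OF W gW[OF zH] w] by blast
  qed
  have im: "g ` insert w H = insert w (g ` H)" using gw by simp
  have wG: "w \<notin> g ` H" using inj H(2) gw 
    unfolding inj_on_def by (metis imageE insertCI)
  have "independent (insert w (g ` H))"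
    using free_family_independent_image[OF _ free] H(1) im by simp
  moreover have cH: "card (g ` H) = card H" using inj by (simp add: card_image)
  moreover have D: "sharing_triangle W w = g ` H \<union> (\<lambda>g. w - g) ` (g ` H)"
  proof -
    have "{h, w - h} = {g h, w - g h}" for h by (auto simp: g_def)
    then have "(\<Union>h\<in>H. {h, w - h}) = (\<Union>h\<in>H. {g h, w - g h})" by simp
    then show ?thesis unfolding H(5) by blast
  qed
  moreover have "card (g ` H) + 1 = n"
  proof -
    have "2 * (n - 1) = card (sharing_triangle W w)"
      using extremal_card_sharing_triangle[OF W n card w] by simp
    also have "\<dots> \<le> card H + card ((\<lambda>h. w - h) ` H)" unfolding H(5) by (rule card_Un_le)
    also have "\<dots> \<le> card H + card H" using card_image_le[OF H(1)] by simp
    finally show ?thesis using H(4) cH by simp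
  qed
  moreover have "a - b \<in> W" if "a \<in> g ` H" "b \<in> g ` H" "a \<noteq> b" for a b
    using that diff by auto
  ultimately show thesis using that[of "g ` H"] H(1) wG by blast
qed

lemma extremal_unimodular:
  assumes W: "unimodular_system W" and n: "rank_at_most W n" and card: "card W = n * (n + 1)"
    and pos: "n > 0"
  obtains E where "finite E" "independent E" "card E = n"
    "W = E \<union> uminus ` E \<union> {a - b | a b. a \<in> E \<and> b \<in> E \<and> a \<noteq> b}"
proof -
  have "W \<noteq> {}" using card pos by auto
  then obtain w where w: "w \<in> W" by blast
  obtain G where G: "finite G" "w \<notin> G" "independent (insert w G)" "card G + 1 = n"
    "sharing_triangle W w = G \<union> (\<lambda>g. w - g) ` G" "\<And>a b. a \<in> G \<Longrightarrow> b \<in> G \<Longrightarrow> a \<noteq> b \<Longrightarrow> a - b \<in> W"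
    using extremal_clique[OF W n card w] by metis
  let ?E = "insert w G"
  let ?R = "?E \<union> uminus ` ?E \<union> {a - b | a b. a \<in> ?E \<and> b \<in> ?E \<and> a \<noteq> b}"
  let ?D = "sharing_triangle W w"
  have GD: "g \<in> W \<and> g - w \<in> W" if "g \<in> G" for g using that G(5) by (auto simp: sharing_triangle_def)
  have free: "free_family ?E (\<lambda>x. x)" using free_family_id_iff[of ?E] G by simp
  have "W \<subseteq> ?R"
  proof
    fix x assume x: "x \<in> W"
    have D: "y \<in> ?R \<and> - y \<in> ?R" if "y \<in> ?D" for y
    proof -
      from that G(5) consider "y \<in> G" | g where "g \<in> G" "y = w - g" by blast
      then show ?thesis
      proof cases
        case 1
        then show ?thesis by blast
      next
        case 2
        then have "- y = g - w" "g \<noteq> w" using G(2) by auto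
        then show ?thesis using 2 by blast
      qed
    qed
    show "x \<in> ?R"
    proof (cases "x \<in> {w, - w} \<union> ?D \<union> uminus ` ?D")
      case True
      then show ?thesis using D by blast
    next
      case False
      then obtain a b where ab: "a \<in> G" "b \<in> G" "a \<noteq> b" "x \<in> {a - b, a + b - w, w - a - b}"
        using extremal_other_form[OF W n card w G(5), of x] x by blast
      have "p = 0 \<and> q = 0 \<and> r = 0" if "p *\<^sub>R a + q *\<^sub>R b + r *\<^sub>R w = 0" for p q r
        using free_family_three[OF _ free, of a b w p q r] G(1,2) ab that by auto
      then have "a + b - w \<notin> W"
        using difference_excludes_sum[OF W _ w G(6)[OF ab(1-3)]] GD[OF ab(1)] by blast
      moreover from this have "w - a - b \<notin> W"
        using unimodular_diff_commute[OF W, of "a + b" w] by (simp add: algebra_simps)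
      ultimately have "x = a - b" using x ab(4) by auto
      then show ?thesis using ab by blast
    qed
  qed
  moreover have "?R \<subseteq> W"
    using w GD G(6) unimodular_uminus_iff[OF W] unimodular_diff_commute[OF W] by auto
  ultimately have "W = ?R" by blast
  then show thesis using that[of ?E] G by simp
qed

section \<open>Characters and eigenvectors\<close>

text \<open>Additivity gives homogeneity for rational factors, and these are dense.\<close>

lemma continuous_additive_linear:
  fixes f :: "'a::real_normed_vector \<Rightarrow> real"
  assumes add: "\<And>x y. f (x + y) = f x + f y" and cont: "continuous_on UNIV f"
  shows "linear f"
proof (rule linearI[OF add])
  fix r x
  have 0: "f 0 = 0" using add[of 0 0] by simp
  have neg: "f (- x) = - f x" for x using add[of x "- x"] 0 by simp
  have nat: "f (of_nat n *\<^sub>R x) = of_nat n * f x" for n x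
    by (induction n) (simp_all add: 0 add algebra_simps)
  have int: "f (of_int i *\<^sub>R x) = of_int i * f x" for i x
    by (cases i rule: int_cases2) (simp_all add: nat neg)
  have rat: "f (q *\<^sub>R x) = q * f x" if "q \<in> \<rat>" for q x
  proof -
    obtain a b :: int where q: "q = of_int a / of_int b" "b \<noteq> 0"
      using \<open>q \<in> \<rat>\<close> by (auto elim!: Rats_cases')
    have "of_int b * f (q *\<^sub>R x) = f (of_int b *\<^sub>R (q *\<^sub>R x))" by (rule int[symmetric])
    also have "\<dots> = of_int a * f x" using q int[of a x] by simp
    finally show ?thesis using q(2) unfolding q(1) by (simp add: divide_simps mult.commute)
  qed
  have "continuous_on UNIV (\<lambda>r. f (r *\<^sub>R x))"
    by (rule continuous_on_compose2[OF cont]) (auto intro!: continuous_intros)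
  then have "closed {r. f (r *\<^sub>R x) = r * f x}"
    by (intro closed_Collect_eq continuous_intros) auto
  then have "closure \<rat> \<subseteq> {r. f (r *\<^sub>R x) = r * f x}" by (rule closure_minimal[rotated]) (use rat in blast)
  then show "f (r *\<^sub>R x) = r *\<^sub>R f x" unfolding Rats_closure_real by auto
qed

lemma cis_two_pi_eq_1_iff: "cis (2 * pi * t) = 1 \<longleftrightarrow> t \<in> \<int>"
proof -
  have "cis (2 * pi * t) = 1 \<longleftrightarrow> cos (2 * pi * t) = 1"
    by (auto simp: complex_eq_iff intro: sin_zero_abs_cos_one) (metis cos_one_sin_zero)
  also have "\<dots> \<longleftrightarrow> (\<exists>n::int. t = n)" unfolding cos_one_2pi_int by auto
  also have "\<dots> \<longleftrightarrow> t \<in> \<int>" by (auto simp: Ints_def)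
  finally show ?thesis .
qed

text \<open>A character has a continuous logarithm, since the space is contractible. The defect of additivity of
  this logarithm is integral and continuous, hence constant, and it vanishes at the origin.\<close>

lemma continuous_character_eq_cis:
  fixes \<xi> :: "'a::real_normed_vector \<Rightarrow> complex"
  assumes cont: "continuous_on UNIV \<xi>" and hom: "\<And>x y. \<xi> (x + y) = \<xi> x * \<xi> y"
    and norm: "\<And>x. cmod (\<xi> x) = 1"
  obtains h :: "'a \<Rightarrow> real" where "linear h" "continuous_on UNIV h" "\<And>x. \<xi> x = cis (2 * pi * h x)"
proof -
  have nz: "\<xi> x \<noteq> 0" for x using norm[of x] by auto
  have "contractible (UNIV :: 'a set)" by (rule convex_imp_contractible) simp
  then obtain g where g: "continuous_on UNIV g" "\<And>x. \<xi> x = exp (g x)"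
    using continuous_logarithm_on_contractible[OF cont] nz by auto
  define h where "h = (\<lambda>x. (Im (g x) - Im (g 0)) / (2 * pi))"
  have \<xi>0: "\<xi> 0 = 1" using hom[of 0 0] nz[of 0] by simp
  have "\<xi> x = cis (Im (g x))" for x
    using norm[of x] g(2)[of x] by (metis exp_eq_polar norm_exp_eq_Re mult_1 of_real_1)
  then have \<xi>h: "\<xi> x = cis (2 * pi * h x)" for x
    using \<xi>0 by (simp add: h_def cis_divide[symmetric])
  have conth: "continuous_on UNIV h" unfolding h_def by (intro continuous_intros g) auto
  have "h (x + y) = h x + h y" for x y
  proof -
    define k where "k = (\<lambda>x. h (x + y) - h x - h y)"
    have int: "k x \<in> \<int>" for x
    proof -
      have "cis (2 * pi * k x) = \<xi> (x + y) / \<xi> x / \<xi> y"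
        by (simp add: k_def \<xi>h cis_divide algebra_simps)
      then show ?thesis using nz by (simp add: hom flip: cis_two_pi_eq_1_iff)
    qed
    have "k constant_on UNIV"
    proof (rule continuous_discrete_range_constant)
      show "continuous_on UNIV k" unfolding k_def
        by (intro continuous_intros conth continuous_on_compose2[OF conth]) auto
      fix x
      have "1 \<le> norm (k y - k x)" if "k y \<noteq> k x" for y
        using Ints_nonzero_abs_ge1[of "k y - k x"] int that by auto
      then show "\<exists>e>0. \<forall>y. y \<in> UNIV \<and> k y \<noteq> k x \<longrightarrow> e \<le> norm (k y - k x)"
        using zero_less_one by blast
    qed auto
    then have "k x = k 0" by (auto simp: constant_on_def)
    moreover have "h 0 = 0" by (simp add: h_def)
    ultimately show ?thesis by (simp add: k_def)
  qed
  then have "linear h" using continuous_additive_linear conth by blast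
  then show thesis using that conth \<xi>h by blast
qed

text \<open>A maximiser of the Rayleigh quotient on the unit sphere of \<open>W\<close> is an eigenvector.\<close>

lemma symmetric_map_eigenvector:
  fixes A :: "'v::euclidean_space \<Rightarrow> 'v"
  assumes W: "subspace W" "W \<noteq> {0}" and A: "linear A" "\<And>w. w \<in> W \<Longrightarrow> A w \<in> W"
    and sym: "\<And>u v. u \<in> W \<Longrightarrow> v \<in> W \<Longrightarrow> A u \<bullet> v = u \<bullet> A v"
  obtains l v where "v \<in> W" "v \<noteq> 0" "A v = l *\<^sub>R v"
proof -
  obtain w0 where w0: "w0 \<in> W" "w0 \<noteq> 0" using W subspace_0 by blast
  let ?K = "W \<inter> sphere 0 1"
  have K: "compact ?K" using closed_subspace[OF W(1)] by (intro closed_Int_compact) auto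
  have ne: "?K \<noteq> {}"
  proof -
    have "w0 /\<^sub>R norm w0 \<in> ?K" using w0 W(1) by (simp add: subspace_scale)
    then show ?thesis by blast
  qed
  have "continuous_on ?K (\<lambda>x. x \<bullet> A x)"
    by (intro continuous_intros linear_continuous_on linear_conv_bounded_linear[THEN iffD1] A(1))
  then obtain v where v: "v \<in> ?K" "\<And>y. y \<in> ?K \<Longrightarrow> y \<bullet> A y \<le> v \<bullet> A v"
    using continuous_attains_sup[OF K ne] by metis
  define l where "l = v \<bullet> A v"
  define r where "r = A v - l *\<^sub>R v"
  have vW: "v \<in> W" and v1: "v \<bullet> v = 1" using v(1) by (auto simp: dot_square_norm)
  have le: "w \<bullet> A w \<le> l * (w \<bullet> w)" if w: "w \<in> W" for w
  proof (cases "w = 0")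
    case False
    let ?y = "w /\<^sub>R norm w"
    have "?y \<in> ?K" using w W(1) False by (simp add: subspace_scale)
    from v(2)[OF this] have "(w \<bullet> A w) / (norm w * norm w) \<le> l"
      by (simp add: l_def linear_scale[OF A(1)] divide_simps)
    then show ?thesis using False by (simp add: dot_square_norm power2_eq_square divide_simps)
  qed simp
  have rW: "r \<in> W" unfolding r_def using vW A(2) W(1) by (intro subspace_diff subspace_scale) auto
  have "r = 0"
  proof (rule ccontr)
    assume "r \<noteq> 0"
    then have pos: "r \<bullet> r > 0" by simp
    define C where "C = l * (r \<bullet> r) - r \<bullet> A r"
    \<comment> \<open>For this small t the first-order term of the quotient along r outweighs the second-order term C.\<close>
    define t where "t = (r \<bullet> r) / (\<bar>C\<bar> + 1)"
    have t: "t > 0" using pos by (simp add: t_def add_nonneg_pos)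
    have "(v + t *\<^sub>R r) \<bullet> A (v + t *\<^sub>R r) \<le> l * ((v + t *\<^sub>R r) \<bullet> (v + t *\<^sub>R r))"
      using vW rW W(1) by (intro le subspace_add subspace_scale)
    then have "2 * t * (r \<bullet> A v) + t * t * (r \<bullet> A r) \<le> 2 * t * (l * (r \<bullet> v)) + t * t * (l * (r \<bullet> r))"
      using sym[OF vW rW] v1
      by (simp add: linear_add[OF A(1)] linear_scale[OF A(1)] inner_add_left inner_add_right
          inner_commute l_def algebra_simps)
    then have "t * (2 * (r \<bullet> r)) \<le> t * (t * C)"
      by (simp add: C_def r_def inner_diff_right inner_diff_left inner_commute algebra_simps)
    then have "2 * (r \<bullet> r) \<le> t * C" using t by simp
    also have "\<dots> \<le> t * (\<bar>C\<bar> + 1)" using t by (intro mult_left_mono) auto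
    also have "\<dots> = r \<bullet> r" using abs_ge_zero[of C] by (simp add: t_def)
    finally show False using pos by simp
  qed
  then have "A v = l *\<^sub>R v" by (simp add: r_def)
  then show thesis using that vW v1 by fastforce
qed

section \<open>Irreducible representations of the torus\<close>

lemma torus_exp_add: "torus_exp (x + y) = torus_exp x * torus_exp y"
  by (simp add: torus_exp_def vec_eq_iff cis_mult distrib_left)

lemma torus_exp_in_torus: "torus_exp x \<in> torus"
  by (simp add: torus_exp_def torus_def)

lemma torus_exp_surj: "(torus :: (complex ^ 'd) set) = range torus_exp"
proof
  show "(torus :: (complex ^ 'd) set) \<subseteq> range torus_exp"
  proof
    fix z :: "complex ^ 'd" assume z: "z \<in> torus"
    then have n: "cmod (z $ i) = 1" for i by (simp add: torus_def)
    then have "z $ i \<noteq> 0" for i by (metis norm_zero zero_neq_one)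
    moreover have "sgn (z $ i) = z $ i" for i by (simp add: sgn_eq n)
    ultimately have "z = torus_exp (\<chi> i. Arg (z $ i) / (2 * pi))"
      by (simp add: torus_exp_def vec_eq_iff cis_Arg)
    then show "z \<in> range torus_exp" by blast
  qed
qed (use torus_exp_in_torus in auto)

lemma torus_exp_eq_iff: "torus_exp x = torus_exp y \<longleftrightarrow> (\<forall>i. (x - y) $ i \<in> \<int>)"
proof -
  have "cis (2 * pi * a) = cis (2 * pi * b) \<longleftrightarrow> a - b \<in> \<int>" for a b
  proof -
    have "cis (2 * pi * a) = cis (2 * pi * b) \<longleftrightarrow> cis (2 * pi * (a - b)) = 1"
      by (simp add: right_diff_distrib cis_divide[symmetric])
    then show ?thesis by (simp add: cis_two_pi_eq_1_iff)
  qed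
  then show ?thesis by (simp add: torus_exp_def vec_eq_iff)
qed

text \<open>The action of the Lie algebra through the exponential map. As \<^const>\<open>torus_exp\<close> is onto the torus, it carries the same
  information as \<open>\<rho>\<close>, but its parameters form a contractible group in which division by two is possible.\<close>

definition act ::
    "(complex ^ 'd \<Rightarrow> 'v::euclidean_space \<Rightarrow> 'v) \<Rightarrow> real ^ 'd \<Rightarrow> 'v \<Rightarrow> 'v" where
  "act \<rho> x = \<rho> (torus_exp x)"

context
  fixes \<rho> :: "complex ^ 'd \<Rightarrow> 'v::euclidean_space \<Rightarrow> 'v"
  assumes rep: "torus_rep \<rho>"
begin

lemma orthogonal_act: "orthogonal_transformation (act \<rho> x)"
  using rep torus_exp_in_torus[of x]
  by (auto simp: act_def torus_rep_def special_orthogonal_def)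

lemma linear_act: "linear (act \<rho> x)"
  using orthogonal_act by (simp add: orthogonal_transformation_def)

lemma act_add: "act \<rho> (x + y) v = act \<rho> x (act \<rho> y v)"
proof -
  have "\<rho> (torus_exp x * torus_exp y) = \<rho> (torus_exp x) \<circ> \<rho> (torus_exp y)"
    using rep torus_exp_in_torus unfolding torus_rep_def by blast
  then show ?thesis by (simp add: act_def torus_exp_add)
qed

lemma act_0: "act \<rho> 0 v = v"
proof -
  have "act \<rho> 0 (act \<rho> 0 v) = act \<rho> 0 v" using act_add[of 0 0] by simp
  then show ?thesis using orthogonal_transformation_inj[OF orthogonal_act] by (metis injD)
qed

lemma act_uminus [simp]: "act \<rho> (- x) (act \<rho> x v) = v" "act \<rho> x (act \<rho> (- x) v) = v"
  using act_add[of "- x" x] act_add[of x "- x"] act_0 by simp_all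

lemma act_commute: "act \<rho> x (act \<rho> y v) = act \<rho> y (act \<rho> x v)"
  by (metis act_add add.commute)

lemma act_adjoint: "act \<rho> x u \<bullet> v = u \<bullet> act \<rho> (- x) v"
  using orthogonal_act[of x] act_uminus(2)[of x v] unfolding orthogonal_transformation_def by metis

lemma continuous_act: "continuous_on UNIV (\<lambda>x. act \<rho> x v)"
proof -
  have "continuous_on torus (\<lambda>z. \<rho> z v)" using rep by (simp add: torus_rep_def)
  moreover have "continuous_on UNIV (torus_exp :: real ^ 'd \<Rightarrow> _)"
    unfolding torus_exp_def by (intro continuous_intros)
  ultimately show ?thesis unfolding act_def
    by (rule continuous_on_compose2) (use torus_exp_in_torus in auto)
qed

lemma subrep_iff_act: "subrep \<rho> W \<longleftrightarrow> subspace W \<and> (\<forall>x. \<forall>w\<in>W. act \<rho> x w \<in> W)"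
  unfolding subrep_def torus_exp_surj act_def by auto

lemma isotropy_group_act: "isotropy_group \<rho> v = torus_exp ` {x. act \<rho> x v = v}"
  unfolding isotropy_group_def torus_exp_surj act_def by auto

text \<open>Schur's lemma over the reals, for symmetric operators: an eigenspace is a subrepresentation.\<close>

lemma irreducible_symmetric_scalar:
  assumes W: "irreducible_subrep \<rho> W" and A: "linear A" "\<And>w. w \<in> W \<Longrightarrow> A w \<in> W"
    and sym: "\<And>u v. u \<in> W \<Longrightarrow> v \<in> W \<Longrightarrow> A u \<bullet> v = u \<bullet> A v"
    and comm: "\<And>x w. w \<in> W \<Longrightarrow> A (act \<rho> x w) = act \<rho> x (A w)"
  obtains l where "\<And>w. w \<in> W \<Longrightarrow> A w = l *\<^sub>R w"
proof -
  have sub: "subspace W" "\<And>x w. w \<in> W \<Longrightarrow> act \<rho> x w \<in> W" and nz: "W \<noteq> {0}"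
    using W by (auto simp: irreducible_subrep_def subrep_iff_act)
  obtain l v where v: "v \<in> W" "v \<noteq> 0" "A v = l *\<^sub>R v"
    using symmetric_map_eigenvector[OF sub(1) nz A sym] by metis
  let ?U = "{w \<in> W. A w = l *\<^sub>R w}"
  have "subspace ?U"
    using sub(1) by (auto simp: subspace_def linear_add[OF A(1)] linear_scale[OF A(1)]
        linear_0[OF A(1)] scaleR_right_distrib)
  then have "subrep \<rho> ?U"
    using sub(2) comm by (auto simp: subrep_iff_act linear_scale[OF linear_act])
  moreover have "?U \<noteq> {0}" using v by blast
  ultimately have "?U = W" using W unfolding irreducible_subrep_def by blast
  then show thesis using that[of l] by blast
qed

lemma act_symmetrization_scalar:
  assumes W: "irreducible_subrep \<rho> W"
  obtains a where "\<And>w. w \<in> W \<Longrightarrow> act \<rho> x w + act \<rho> (- x) w = (2 * a) *\<^sub>R w"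
proof -
  have sub: "subspace W" "\<And>x w. w \<in> W \<Longrightarrow> act \<rho> x w \<in> W"
    using W by (auto simp: irreducible_subrep_def subrep_iff_act)
  obtain l where "\<And>w. w \<in> W \<Longrightarrow> act \<rho> x w + act \<rho> (- x) w = l *\<^sub>R w"
  proof (rule irreducible_symmetric_scalar[OF W, of "\<lambda>w. act \<rho> x w + act \<rho> (- x) w"])
    show "linear (\<lambda>w. act \<rho> x w + act \<rho> (- x) w)"
      by (intro linear_compose_add linear_act)
    show "act \<rho> x w + act \<rho> (- x) w \<in> W" if "w \<in> W" for w
      using sub that by (simp add: subspace_add)
    show "(act \<rho> x u + act \<rho> (- x) u) \<bullet> v = u \<bullet> (act \<rho> x v + act \<rho> (- x) v)" for u v
      by (simp add: inner_add_left inner_add_right act_adjoint)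
    show "act \<rho> x (act \<rho> y w) + act \<rho> (- x) (act \<rho> y w) = act \<rho> y (act \<rho> x w + act \<rho> (- x) w)" for y w
      by (simp add: linear_add[OF linear_act] act_commute)
  qed (blast intro: that)
  then show thesis using that[of "l / 2"] by simp
qed

text \<open>Some element acts on \<open>W\<close> as a rotation \<open>g\<close> by an angle whose cosine \<open>a\<close> satisfies \<open>\<bar>a\<bar> < 1\<close>: if an
  element acts as \<open>-1\<close>, its square root does. As \<open>g + inverse g = 2 a\<close>, the operator
  \<open>J = (g - a) / sqrt (1 - a\<^sup>2)\<close> is a complex structure, and it commutes with the commutative group.\<close>

lemma nontrivial_irreducible_complex_structure:
  assumes W: "W \<in> nontrivial_irreducible_subreps \<rho>"
  obtains J where "linear J" "\<And>w. w \<in> W \<Longrightarrow> J w \<in> W" "\<And>w. w \<in> W \<Longrightarrow> J (J w) = - w"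
    "\<And>u v. u \<in> W \<Longrightarrow> v \<in> W \<Longrightarrow> J u \<bullet> v = - (u \<bullet> J v)"
    "\<And>x w. w \<in> W \<Longrightarrow> J (act \<rho> x w) = act \<rho> x (J w)"
proof -
  have irr: "irreducible_subrep \<rho> W" and nontriv: "\<not> trivial_subrep \<rho> W"
    using W by (auto simp: nontrivial_irreducible_subreps_def)
  then have sub: "subrep \<rho> W" "subspace W" "\<And>x w. w \<in> W \<Longrightarrow> act \<rho> x w \<in> W"
    by (auto simp: irreducible_subrep_def subrep_iff_act)
  then have "\<exists>x. \<exists>w\<in>W. act \<rho> x w \<noteq> w"
    using nontriv unfolding trivial_subrep_def torus_exp_surj act_def by auto
  then obtain x1 w1 where w1: "w1 \<in> W" "act \<rho> x1 w1 \<noteq> w1" by blast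
  have abs_less: "\<bar>a\<bar> < 1"
    if a: "\<And>w. w \<in> W \<Longrightarrow> act \<rho> x w + act \<rho> (- x) w = (2 * a) *\<^sub>R w"
      and u: "u \<in> W" "act \<rho> x u \<noteq> u" "act \<rho> x u \<noteq> - u" for x a u
  proof -
    have uu: "act \<rho> x u \<bullet> act \<rho> x u = u \<bullet> u" by (simp add: act_adjoint)
    have "act \<rho> (- x) u \<bullet> u = act \<rho> x u \<bullet> u"
      using act_adjoint[of "- x" u u] by (simp add: inner_commute)
    then have "2 * (act \<rho> x u \<bullet> u) = act \<rho> x u \<bullet> u + act \<rho> (- x) u \<bullet> u" by simp
    also have "\<dots> = 2 * a * (u \<bullet> u)" using a[OF u(1)] by (metis inner_add_left inner_scaleR_left)
    finally have au: "act \<rho> x u \<bullet> u = a * (u \<bullet> u)" by simp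
    have "u \<noteq> 0" using u(2) linear_0[OF linear_act] by metis
    then have pos: "u \<bullet> u > 0" by simp
    have "(act \<rho> x u - u) \<bullet> (act \<rho> x u - u) > 0" "(act \<rho> x u + u) \<bullet> (act \<rho> x u + u) > 0"
      using u by (auto simp: eq_neg_iff_add_eq_0)
    then have "2 * (1 - a) * (u \<bullet> u) > 0" "2 * (1 + a) * (u \<bullet> u) > 0"
      using au uu by (simp_all add: inner_diff_left inner_diff_right inner_add_left inner_add_right
          inner_commute algebra_simps)
    then show ?thesis using pos by (simp add: zero_less_mult_iff abs_less_iff)
  qed
  obtain x a where a: "\<And>w. w \<in> W \<Longrightarrow> act \<rho> x w + act \<rho> (- x) w = (2 * a) *\<^sub>R w" "\<bar>a\<bar> < 1"
  proof (cases "act \<rho> x1 w1 = - w1")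
    case False
    obtain a where "\<And>w. w \<in> W \<Longrightarrow> act \<rho> x1 w + act \<rho> (- x1) w = (2 * a) *\<^sub>R w"
      using act_symmetrization_scalar[OF irr] by metis
    then show thesis using that abs_less w1 False by blast
  next
    case True
    \<comment> \<open>Here x1 acts as -1 on w1, so half of x1 acts on w1 neither as 1 nor as -1.\<close>
    let ?x = "(1 / 2) *\<^sub>R x1"
    have half: "act \<rho> ?x (act \<rho> ?x w1) = - w1"
      using True by (simp add: act_add[symmetric] flip: scaleR_left_distrib)
    have "w1 \<noteq> 0" using w1(2) linear_0[OF linear_act] by metis
    then have "w1 \<noteq> - w1" by (metis add.right_inverse scaleR_2 scaleR_eq_0_iff zero_neq_numeral)
    then have "act \<rho> ?x w1 \<noteq> w1" "act \<rho> ?x w1 \<noteq> - w1"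
      using half linear_neg[OF linear_act, of ?x w1] by auto
    moreover obtain a where "\<And>w. w \<in> W \<Longrightarrow> act \<rho> ?x w + act \<rho> (- ?x) w = (2 * a) *\<^sub>R w"
      using act_symmetrization_scalar[OF irr] by metis
    ultimately show thesis using that abs_less w1(1) by blast
  qed
  define s where "s = sqrt (1 - a\<^sup>2)"
  have "a\<^sup>2 < 1" using a(2) by (simp add: abs_square_less_1)
  then have s: "s > 0" "s * s = 1 - a\<^sup>2" by (simp_all add: s_def flip: power2_eq_square)
  define J where "J = (\<lambda>w. (act \<rho> x w - a *\<^sub>R w) /\<^sub>R s)"
  have linJ: "linear J"
    by (rule linearI) (simp_all add: J_def linear_add[OF linear_act] linear_scale[OF linear_act]
        algebra_simps)
  have inv: "act \<rho> (- x) w = (2 * a) *\<^sub>R w - act \<rho> x w" if "w \<in> W" for w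
    using a(1)[OF that] by (simp add: algebra_simps)
  have sq: "act \<rho> x (act \<rho> x w) = (2 * a) *\<^sub>R act \<rho> x w - w" if "w \<in> W" for w
    using a(1)[OF sub(3)[OF that], of x] by (simp add: algebra_simps)
  show thesis
  proof
    show "linear J" by (rule linJ)
    show "J w \<in> W" if "w \<in> W" for w
      using that sub by (simp add: J_def subspace_scale subspace_diff)
    show "J (J w) = - w" if w: "w \<in> W" for w
    proof -
      have sJ: "s *\<^sub>R J w = act \<rho> x w - a *\<^sub>R w" for w using s(1) by (simp add: J_def)
      have twice: "(2 * a) *\<^sub>R z = a *\<^sub>R z + a *\<^sub>R z" for z :: 'v by (simp flip: scaleR_left_distrib)
      have "(s * s) *\<^sub>R J (J w) = s *\<^sub>R (act \<rho> x (J w) - a *\<^sub>R J w)" by (simp flip: sJ)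
      also have "\<dots> = act \<rho> x (s *\<^sub>R J w) - a *\<^sub>R (s *\<^sub>R J w)"
        by (simp add: linear_scale[OF linear_act] scaleR_diff_right mult.commute)
      also have "\<dots> = act \<rho> x (act \<rho> x w) - (2 * a) *\<^sub>R act \<rho> x w + a\<^sup>2 *\<^sub>R w"
        by (simp add: sJ twice linear_diff[OF linear_act] linear_scale[OF linear_act]
            scaleR_diff_right power2_eq_square)
      also have "\<dots> = (s * s) *\<^sub>R (- w)" unfolding sq[OF w] s(2) by (simp add: algebra_simps)
      finally have "(s * s) *\<^sub>R J (J w) = (s * s) *\<^sub>R (- w)" .
      then show ?thesis using s(1) unfolding scaleR_cancel_left by simp
    qed
    show "J u \<bullet> v = - (u \<bullet> J v)" if "u \<in> W" "v \<in> W" for u v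
    proof -
      have "act \<rho> x u \<bullet> v = 2 * a * (u \<bullet> v) - u \<bullet> act \<rho> x v"
        unfolding act_adjoint inv[OF that(2)] by (simp add: inner_diff_right)
      then have "(act \<rho> x u - a *\<^sub>R u) \<bullet> v = - (u \<bullet> (act \<rho> x v - a *\<^sub>R v))"
        by (simp add: inner_diff_left inner_diff_right)
      then show ?thesis unfolding J_def inner_scaleR_left inner_scaleR_right by simp
    qed
    show "J (act \<rho> y w) = act \<rho> y (J w)" for y w
      by (simp add: J_def linear_diff[OF linear_act] linear_scale[OF linear_act] act_commute)
  qed
qed

text \<open>With \<open>J\<close> as the imaginary unit, every group element acts as a complex number: its symmetric part is
  scalar by Schur's lemma, and its skew part becomes symmetric when composed with \<open>J\<close>. So the complex
  line of any vector is invariant and is all of \<open>W\<close>. The complex numbers form a character.\<close>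

lemma nontrivial_irreducible_has_weight:
  assumes W: "W \<in> nontrivial_irreducible_subreps \<rho>"
  obtains h where "is_weight_of \<rho> W h"
proof -
  have irr: "irreducible_subrep \<rho> W" and nontriv: "\<not> trivial_subrep \<rho> W"
    using W by (auto simp: nontrivial_irreducible_subreps_def)
  then have sub: "subrep \<rho> W" "subspace W" "\<And>x w. w \<in> W \<Longrightarrow> act \<rho> x w \<in> W" and nz: "W \<noteq> {0}"
    by (auto simp: irreducible_subrep_def subrep_iff_act)
  obtain J where J: "linear J" "\<And>w. w \<in> W \<Longrightarrow> J w \<in> W" "\<And>w. w \<in> W \<Longrightarrow> J (J w) = - w"
    "\<And>u v. u \<in> W \<Longrightarrow> v \<in> W \<Longrightarrow> J u \<bullet> v = - (u \<bullet> J v)"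
    "\<And>x w. w \<in> W \<Longrightarrow> J (act \<rho> x w) = act \<rho> x (J w)"
    using nontrivial_irreducible_complex_structure[OF W] by metis
  have "\<exists>a b. \<forall>w\<in>W. act \<rho> x w = a *\<^sub>R w + b *\<^sub>R J w" for x
  proof -
    obtain a where a: "\<And>w. w \<in> W \<Longrightarrow> act \<rho> x w + act \<rho> (- x) w = (2 * a) *\<^sub>R w"
      using act_symmetrization_scalar[OF irr] by metis
    let ?K = "\<lambda>w. act \<rho> x w - act \<rho> (- x) w"
    have K: "linear ?K" by (intro linear_compose_sub linear_act)
    have KW: "?K w \<in> W" if "w \<in> W" for w using sub that by (simp add: subspace_diff)
    have KJ: "J (?K w) = ?K (J w)" if "w \<in> W" for w
      using J(5)[OF that] by (simp add: linear_diff[OF J(1)])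
    obtain l where l: "\<And>w. w \<in> W \<Longrightarrow> ?K (J w) = l *\<^sub>R w"
    proof (rule irreducible_symmetric_scalar[OF irr, of "\<lambda>w. ?K (J w)"])
      show "linear (\<lambda>w. ?K (J w))" using linear_compose[OF J(1) K] by (simp add: o_def)
      show "?K (J w) \<in> W" if "w \<in> W" for w using J(2) KW that by blast
      show "?K (J u) \<bullet> v = u \<bullet> ?K (J v)" if "u \<in> W" "v \<in> W" for u v
      proof -
        have "?K (J u) \<bullet> v = - (J u \<bullet> ?K v)"
          using act_adjoint[of "- x" "J u" v] act_adjoint[of x "J u" v]
          by (simp add: inner_diff_left inner_diff_right)
        also have "\<dots> = u \<bullet> ?K (J v)" using J(4)[OF that(1) KW[OF that(2)]] KJ[OF that(2)] by simp
        finally show ?thesis .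
      qed
      show "?K (J (act \<rho> y w)) = act \<rho> y (?K (J w))" if "w \<in> W" for y w
        using J(5)[OF that] by (simp add: linear_diff[OF linear_act] act_commute)
    qed (blast intro: that)
    have "act \<rho> x w = a *\<^sub>R w + (- l / 2) *\<^sub>R J w" if w: "w \<in> W" for w
    proof -
      have "?K w = - ?K (J (J w))" using J(3)[OF w] by (simp add: linear_neg[OF linear_act])
      also have "\<dots> = - l *\<^sub>R J w" using l[OF J(2)[OF w]] by simp
      finally have skew: "?K w = - l *\<^sub>R J w" .
      have "2 *\<^sub>R act \<rho> x w = (act \<rho> x w + act \<rho> (- x) w) + ?K w" by (simp add: scaleR_2)
      also have "\<dots> = (2 * a) *\<^sub>R w - l *\<^sub>R J w" unfolding a[OF w] skew by simp
      finally have "2 *\<^sub>R act \<rho> x w = (2 * a) *\<^sub>R w - l *\<^sub>R J w" .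
      then have "(1 / 2) *\<^sub>R 2 *\<^sub>R act \<rho> x w = (1 / 2) *\<^sub>R ((2 * a) *\<^sub>R w - l *\<^sub>R J w)" by simp
      then show ?thesis by (simp add: scaleR_diff_right)
    qed
    then show ?thesis by blast
  qed
  then obtain a b where ab: "\<And>x w. w \<in> W \<Longrightarrow> act \<rho> x w = a x *\<^sub>R w + b x *\<^sub>R J w" by metis
  obtain w0 where w0: "w0 \<in> W" "w0 \<noteq> 0" using nz sub(2) subspace_0 by blast
  define v where "v = w0 /\<^sub>R norm w0"
  have v: "v \<in> W" "v \<bullet> v = 1" using w0 sub(2) by (auto simp: v_def subspace_scale dot_square_norm)
  have vJ: "v \<bullet> J v = 0" "J v \<bullet> v = 0" using J(4)[OF v(1) v(1)] by (simp_all add: inner_commute)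
  have JJ: "J v \<bullet> J v = 1" using J(4)[OF v(1) J(2)[OF v(1)]] J(3)[OF v(1)] v(2) by simp
  have actJ: "act \<rho> x (J v) = a x *\<^sub>R J v - b x *\<^sub>R v" for x
    using ab[OF J(2)[OF v(1)], of x] J(3)[OF v(1)] by simp
  have W_eq: "{p *\<^sub>R v + q *\<^sub>R J v | p q. True} = W"
  proof -
    let ?U = "{p *\<^sub>R v + q *\<^sub>R J v | p q. True}"
    have U: "?U = span {v, J v}" unfolding span_insert span_empty by (force simp: algebra_simps)
    have "act \<rho> x u \<in> ?U" if "u \<in> ?U" for x u
    proof -
      obtain p q where u: "u = p *\<^sub>R v + q *\<^sub>R J v" using \<open>u \<in> ?U\<close> by blast
      have "act \<rho> x u = (a x * p - b x * q) *\<^sub>R v + (a x * q + b x * p) *\<^sub>R J v"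
        unfolding u
        by (simp add: ab[OF v(1)] actJ linear_add[OF linear_act] linear_scale[OF linear_act] algebra_simps)
      then show ?thesis by blast
    qed
    then have "subrep \<rho> ?U" unfolding subrep_iff_act using U subspace_span by metis
    moreover have "?U \<subseteq> W" using v(1) J(2) sub(2) by (auto intro!: subspace_add subspace_scale)
    moreover have "v \<in> ?U" using exI[of "\<lambda>p. \<exists>q. v = p *\<^sub>R v + q *\<^sub>R J v" 1]
      by (force intro: exI[of _ 0])
    moreover have "v \<noteq> 0" using v(2) by auto
    then have "?U \<noteq> {0}" using \<open>v \<in> ?U\<close> by blast
    ultimately show ?thesis using irr unfolding irreducible_subrep_def by blast
  qed
  have W_form: "\<exists>p q. u = p *\<^sub>R v + q *\<^sub>R J v" if "u \<in> W" for u using that W_eq by blast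
  define f where "f = (\<lambda>u. Complex (u \<bullet> v) (u \<bullet> J v))"
  have linf: "linear f" by (rule linearI) (simp_all add: f_def inner_add_left complex_eq_iff)
  have f_pq: "f (p *\<^sub>R v + q *\<^sub>R J v) = Complex p q" for p q
    using v(2) vJ JJ by (simp add: f_def inner_add_left)
  have inj: "inj_on f W"
  proof (rule inj_onI)
    fix u u' assume "u \<in> W" "u' \<in> W" "f u = f u'"
    then show "u = u'" unfolding W_eq[symmetric] using f_pq by auto
  qed
  have bij: "bij_betw f W UNIV"
  proof -
    have "z \<in> f ` W" for z
      unfolding W_eq[symmetric] using f_pq[of "Re z" "Im z"] by (metis (mono_tags, lifting) complex_surj imageI mem_Collect_eq)
    then show ?thesis using inj by (auto simp: bij_betw_def)
  qed
  have f_norm: "cmod (f u) = norm u" if "u \<in> W" for u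
  proof -
    obtain p q where u: "u = p *\<^sub>R v + q *\<^sub>R J v" using W_form \<open>u \<in> W\<close> by metis
    have "u \<bullet> u = p\<^sup>2 + q\<^sup>2"
      unfolding u using v(2) vJ JJ by (simp add: inner_add_left inner_add_right power2_eq_square)
    then have "norm u = sqrt (p\<^sup>2 + q\<^sup>2)" by (simp only: norm_eq_sqrt_inner)
    then show ?thesis using f_pq[of p q] u by (simp add: cmod_def)
  qed
  define c where "c = (\<lambda>x. f (act \<rho> x v))"
  have fc: "f (act \<rho> x u) = c x * f u" if "u \<in> W" for x u
  proof -
    obtain p q where u: "u = p *\<^sub>R v + q *\<^sub>R J v" using W_form \<open>u \<in> W\<close> by metis
    have "act \<rho> x u = (a x * p - b x * q) *\<^sub>R v + (a x * q + b x * p) *\<^sub>R J v"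
      unfolding u
      by (simp add: ab[OF v(1)] actJ linear_add[OF linear_act] linear_scale[OF linear_act] algebra_simps)
    then have "f (act \<rho> x u) = Complex (a x * p - b x * q) (a x * q + b x * p)" using f_pq by simp
    moreover have "c x = Complex (a x) (b x)" unfolding c_def ab[OF v(1)] by (rule f_pq)
    moreover have "f u = Complex p q" unfolding u by (rule f_pq)
    ultimately show ?thesis by (simp add: complex_eq_iff algebra_simps)
  qed
  have "continuous_on UNIV c"
    unfolding c_def f_def Complex_eq by (intro continuous_intros continuous_act)
  moreover have "c (x + y) = c x * c y" for x y
    using fc[OF sub(3)[OF v(1)], of x y] by (simp add: c_def act_add)
  moreover have "cmod (c x) = 1" for x
  proof -
    have "cmod (c x) = norm (act \<rho> x v)" unfolding c_def by (rule f_norm[OF sub(3)[OF v(1)]])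
    also have "\<dots> = norm v" using orthogonal_act orthogonal_transformation_norm by blast
    finally show ?thesis using v(2) by (simp add: norm_eq_sqrt_inner)
  qed
  ultimately obtain h where h: "linear h" "continuous_on UNIV h" "\<And>x. c x = cis (2 * pi * h x)"
    using continuous_character_eq_cis by metis
  define H where "H = Blinfun h"
  have "bounded_linear h" using h(1) linear_conv_bounded_linear by blast
  then have H: "blinfun_apply H x = h x" for x by (simp add: H_def bounded_linear_Blinfun_apply)
  have fH: "f (\<rho> (torus_exp x) w) = cis (2 * pi * blinfun_apply H x) * f w" if "w \<in> W" for x w
    using fc[OF that, of x] by (simp add: act_def H h(3))
  have "H \<noteq> 0"
  proof
    assume "H = 0"
    then have "f (act \<rho> x w) = f w" if "w \<in> W" for x w using fH[OF that] by (simp add: act_def)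
    then have "act \<rho> x w = w" if "w \<in> W" for x w using inj sub(3) that by (meson inj_onD)
    then have "trivial_subrep \<rho> W" using sub(1) by (auto simp: trivial_subrep_def torus_exp_surj act_def)
    then show False using nontriv by blast
  qed
  then have "is_weight_of \<rho> W H" using linf bij fH unfolding is_weight_of_def by blast
  then show thesis by (rule that)
qed

text \<open>The symmetrised action sees a weight up to sign only and is scalar on each rotation plane. So
  rotation planes whose weights differ by more than the sign are distinguished by eigenvalues.\<close>

lemma weight_symmetrization:
  assumes W: "subrep \<rho> W" and h: "is_weight_of \<rho> W h" and w: "w \<in> W"
  shows "act \<rho> x w + act \<rho> (- x) w = (2 * cos (2 * pi * blinfun_apply h x)) *\<^sub>R w"
proof -
  have sub: "subspace W" "\<And>x w. w \<in> W \<Longrightarrow> act \<rho> x w \<in> W" using W by (auto simp: subrep_iff_act)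
  obtain f where f: "linear f" "bij_betw f W UNIV"
    "\<And>x w. w \<in> W \<Longrightarrow> f (act \<rho> x w) = cis (2 * pi * blinfun_apply h x) * f w"
    using h unfolding is_weight_of_def act_def by blast
  have "f (act \<rho> x w + act \<rho> (- x) w) = f ((2 * cos (2 * pi * blinfun_apply h x)) *\<^sub>R w)"
    using f(3)[OF w, of x] f(3)[OF w, of "- x"] by (simp add: linear_add[OF f(1)] linear_scale[OF f(1)] blinfun.minus_right
        complex_eq_iff algebra_simps)
  moreover have "act \<rho> x w + act \<rho> (- x) w \<in> W" using sub w by (simp add: subspace_add)
  moreover have "(2 * cos (2 * pi * blinfun_apply h x)) *\<^sub>R w \<in> W" using sub(1) w by (rule subspace_scale)
  ultimately show ?thesis using f(2) by (meson bij_betw_imp_inj_on inj_onD)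
qed

lemma weight_space_nontrivial:
  assumes "subrep \<rho> W" "is_weight_of \<rho> W h"
  obtains w where "w \<in> W" "w \<noteq> 0"
proof -
  obtain f :: "'v \<Rightarrow> complex" where f: "linear f" "bij_betw f W UNIV"
    using assms unfolding is_weight_of_def by blast
  then obtain w where "w \<in> W" "f w = 1" by (metis UNIV_I bij_betw_iff_bijections)
  then show thesis using that linear_0[OF f(1)] by fastforce
qed

end

section \<open>Weights and equivalence\<close>

text \<open>Comparing the cosines near the origin gives \<open>h' x = \<plusminus> h x\<close> at each point. The sign does not depend
  on the point, because a vector space is not the union of two proper subspaces.\<close>

lemma weights_eq_of_cos_eq:
  fixes h h' :: "'a::real_normed_vector \<Rightarrow>\<^sub>L real"
  assumes cos: "\<And>x. cos (2 * pi * blinfun_apply h x) = cos (2 * pi * blinfun_apply h' x)"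
  shows "h' = h \<or> h' = - h"
proof -
  have pm: "h' x = h x \<or> h' x = - h x" for x
  proof -
    define b where "b = 1 + \<bar>h x\<bar> + \<bar>h' x\<bar>"
    have b: "b > 0" "\<bar>h x\<bar> \<le> b" "\<bar>h' x\<bar> \<le> b" by (simp_all add: b_def add_pos_nonneg)
    \<comment> \<open>Shrinking x brings both angles into [0, pi], where the cosine is injective.\<close>
    define t where "t = 1 / (2 * b)"
    have t: "t > 0" using b(1) by (simp add: t_def)
    have "t * \<bar>h x\<bar> \<le> 1 / 2" "t * \<bar>h' x\<bar> \<le> 1 / 2" using b by (simp_all add: t_def divide_simps)
    then have le: "2 * pi * (t * \<bar>h x\<bar>) \<le> pi" "2 * pi * (t * \<bar>h' x\<bar>) \<le> pi"
      using mult_left_mono[of _ "1 / 2" "2 * pi"] pi_ge_zero by force+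
    have cos_abs: "cos (2 * pi * (t * \<bar>h x\<bar>)) = cos (2 * pi * (t * \<bar>h' x\<bar>))"
    proof -
      have abs: "cos (2 * pi * (t * \<bar>k\<bar>)) = cos (2 * pi * (t * k))" for k :: real
        by (cases "k \<ge> 0") simp_all
      show ?thesis using cos[of "t *\<^sub>R x"] unfolding abs by (simp add: blinfun.scaleR_right)
    qed
    have "2 * pi * (t * \<bar>h x\<bar>) = 2 * pi * (t * \<bar>h' x\<bar>)"
      by (rule cos_inj_pi[OF _ le(1) _ le(2) cos_abs]) (use t in simp_all)
    then show ?thesis using t by (auto simp: abs_if split: if_splits)
  qed
  show ?thesis
  proof (rule ccontr)
    assume "\<not> ?thesis"
    then obtain a b where ab: "h' a \<noteq> h a" "h' b \<noteq> - h b"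
      by (metis blinfun_eqI uminus_blinfun.rep_eq)
    then have "h' a = - h a" "h' b = h b" using pm by blast+
    then show False using pm[of "a + b"] ab by (simp add: blinfun.add_right)
  qed
qed

lemma weight_uminus:
  assumes "is_weight_of \<rho> W h"
  shows "is_weight_of \<rho> W (- h)"
proof -
  obtain f where f: "linear f" "bij_betw f W UNIV"
    "\<forall>x. \<forall>w\<in>W. f (\<rho> (torus_exp x) w) = cis (2 * pi * blinfun_apply h x) * f w" and h: "h \<noteq> 0"
    using assms unfolding is_weight_of_def by blast
  have "linear (\<lambda>w. cnj (f w))"
    by (rule linearI) (simp_all add: linear_add[OF f(1)] linear_scale[OF f(1)])
  moreover have "bij_betw (\<lambda>w. cnj (f w)) W UNIV"
    
  proof -
    have "bij_betw cnj UNIV UNIV" by (rule bij_betw_byWitness[where f' = cnj]) auto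
    then show ?thesis using bij_betw_trans[OF f(2)] by (simp add: o_def)
  qed
  moreover have "cnj (f (\<rho> (torus_exp x) w)) = cis (2 * pi * blinfun_apply (- h) x) * cnj (f w)"
    if "w \<in> W" for x w
    using f(3) that by (simp add: blinfun.minus_left cis_cnj)
  ultimately show ?thesis using h unfolding is_weight_of_def by (auto intro!: exI[of _ "\<lambda>w. cnj (f w)"])
qed

lemma weights_uminus: "h \<in> weights \<rho> \<Longrightarrow> - h \<in> weights \<rho>"
  using weight_uminus unfolding weights_def by blast

context
  fixes \<rho> :: "complex ^ 'd \<Rightarrow> 'v::euclidean_space \<Rightarrow> 'v"
  assumes rep: "torus_rep \<rho>"
begin

lemma weight_vectors_orthogonal:
  assumes W: "subrep \<rho> W" "is_weight_of \<rho> W h" and W': "subrep \<rho> W'" "is_weight_of \<rho> W' h'"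
    and hh': "h' \<noteq> h" "h' \<noteq> - h" and w: "w \<in> W" "w' \<in> W'"
  shows "w \<bullet> w' = 0"
proof -
  obtain x where x: "cos (2 * pi * h x) \<noteq> cos (2 * pi * h' x)"
    using weights_eq_of_cos_eq[of h h'] hh' by blast
  have "2 * cos (2 * pi * h x) * (w \<bullet> w') = (act \<rho> x w + act \<rho> (- x) w) \<bullet> w'"
    using weight_symmetrization[OF rep W w(1), of x] by simp
  also have "\<dots> = w \<bullet> (act \<rho> x w' + act \<rho> (- x) w')"
    by (simp add: inner_add_left inner_add_right act_adjoint[OF rep])
  also have "\<dots> = 2 * cos (2 * pi * h' x) * (w \<bullet> w')"
    using weight_symmetrization[OF rep W' w(2), of x] by simp
  finally show ?thesis using x by simp
qed

lemma equivalent_subreps_weights: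
  assumes W: "subrep \<rho> W" "is_weight_of \<rho> W h" and W': "subrep \<rho> W'" "is_weight_of \<rho> W' h'"
    and eq: "equivalent_subreps \<rho> W W'"
  shows "h' = h \<or> h' = - h"
proof (rule weights_eq_of_cos_eq)
  fix x
  have sub: "w \<in> W \<Longrightarrow> act \<rho> x w \<in> W" for x w using W(1) by (simp add: subrep_iff_act[OF rep])
  obtain f where f: "linear f" "bij_betw f W W'" "\<And>x w. w \<in> W \<Longrightarrow> f (act \<rho> x w) = act \<rho> x (f w)"
    using eq torus_exp_in_torus unfolding equivalent_subreps_def act_def by blast
  obtain w where w: "w \<in> W" "w \<noteq> 0" using weight_space_nontrivial[OF rep W] by blast
  have fw: "f w \<in> W'" using f(2) w(1) bij_betwE by blast
  have "0 \<in> W" using W(1) by (simp add: subrep_def subspace_0)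
  then have "f w \<noteq> 0" using w f(2) linear_0[OF f(1)] by (metis bij_betw_imp_inj_on inj_onD)
  moreover have "(2 * cos (2 * pi * h x)) *\<^sub>R f w = (2 * cos (2 * pi * h' x)) *\<^sub>R f w"
  proof -
    have "(2 * cos (2 * pi * h x)) *\<^sub>R f w = f (act \<rho> x w + act \<rho> (- x) w)"
      unfolding weight_symmetrization[OF rep W w(1)] by (simp add: linear_scale[OF f(1)])
    also have "\<dots> = act \<rho> x (f w) + act \<rho> (- x) (f w)"
      using f(3)[OF w(1)] by (simp add: linear_add[OF f(1)])
    also have "\<dots> = (2 * cos (2 * pi * h' x)) *\<^sub>R f w"
      by (rule weight_symmetrization[OF rep W' fw])
    finally show ?thesis .
  qed
  ultimately show "cos (2 * pi * h x) = cos (2 * pi * h' x)" by simp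
qed

lemma same_weight_equivalent_subreps:
  assumes W: "subrep \<rho> W" "is_weight_of \<rho> W h" and W': "subrep \<rho> W'" "is_weight_of \<rho> W' h"
  shows "equivalent_subreps \<rho> W W'"
proof -
  have sub: "w \<in> W' \<Longrightarrow> act \<rho> x w \<in> W'" "subspace W'" for x w
    using W'(1) by (simp_all add: subrep_iff_act[OF rep])
  obtain f :: "'v \<Rightarrow> complex" where f: "linear f" "bij_betw f W UNIV"
    "\<And>x w. w \<in> W \<Longrightarrow> f (act \<rho> x w) = cis (2 * pi * blinfun_apply h x) * f w"
    using W(2) unfolding is_weight_of_def act_def by blast
  obtain f' :: "'v \<Rightarrow> complex" where f': "linear f'" "bij_betw f' W' UNIV"
    "\<And>x w. w \<in> W' \<Longrightarrow> f' (act \<rho> x w) = cis (2 * pi * blinfun_apply h x) * f' w"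
    using W'(2) unfolding is_weight_of_def act_def by blast
  obtain g where "range g \<subseteq> W'" "linear g" "\<forall>z\<in>f' ` W'. f' (g z) = z"
    using linear_exists_right_inverse_on[OF f'(1) sub(2)] by blast
  moreover have "f' ` W' = UNIV" using f'(2) by (simp add: bij_betw_def)
  ultimately have g: "range g \<subseteq> W'" "linear g" "\<And>z. f' (g z) = z" by auto
  have gW: "g z \<in> W'" for z using g(1) by blast
  have inj: "u = v" if "f' u = f' v" "u \<in> W'" "v \<in> W'" for u v
    using f'(2) that by (meson bij_betw_imp_inj_on inj_onD)
  have "bij_betw g UNIV W'"
  proof (rule bij_betwI')
    show "(g y = g z) = (y = z)" for y z using g(3) by metis
    show "\<exists>z\<in>UNIV. w = g z" if "w \<in> W'" for w using inj[of w "g (f' w)"] gW g(3) that by auto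
  qed (use gW in auto)
  then have "bij_betw (g \<circ> f) W W'" using f(2) bij_betw_trans by blast
  moreover have "linear (g \<circ> f)" by (rule linear_compose[OF f(1) g(2)])
  moreover have "(g \<circ> f) (act \<rho> x w) = act \<rho> x ((g \<circ> f) w)" if "w \<in> W" for x w
    using inj[of "g (f (act \<rho> x w))" "act \<rho> x (g (f w))"] gW sub(1) g(3) f(3)[OF that]
      f'(3)[OF gW] by simp
  ultimately show ?thesis unfolding equivalent_subreps_def torus_exp_surj act_def by blast
qed

lemma weights_cases:
  assumes "h \<in> weights \<rho>"
  obtains W where "W \<in> nontrivial_irreducible_subreps \<rho>" "subrep \<rho> W" "is_weight_of \<rho> W h"
  using assms unfolding weights_def nontrivial_irreducible_subreps_def irreducible_subrep_def by blast

lemma act_fixes_iff: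
  assumes W: "subrep \<rho> W" "is_weight_of \<rho> W h" and w: "w \<in> W" "w \<noteq> 0"
  shows "act \<rho> x w = w \<longleftrightarrow> h x \<in> \<int>"
proof -
  have sub: "act \<rho> x w \<in> W" "0 \<in> W" using W(1) w by (simp_all add: subrep_iff_act[OF rep] subspace_0)
  obtain f :: "'v \<Rightarrow> complex" where f: "linear f" "bij_betw f W UNIV"
    "\<And>x w. w \<in> W \<Longrightarrow> f (act \<rho> x w) = cis (2 * pi * blinfun_apply h x) * f w"
    using W(2) unfolding is_weight_of_def act_def by blast
  have inj: "inj_on f W" using f(2) by (rule bij_betw_imp_inj_on)
  have "f w \<noteq> 0" using inj_onD[OF inj _ w(1) sub(2)] w(2) linear_0[OF f(1)] by auto
  moreover have "act \<rho> x w = w \<longleftrightarrow> f (act \<rho> x w) = f w" using inj_on_eq_iff[OF inj sub(1) w(1)] by simp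
  ultimately show ?thesis unfolding f(3)[OF w(1)] cis_two_pi_eq_1_iff[symmetric] by simp
qed

lemma weight_integral_on_lattice:
  assumes h: "h \<in> weights \<rho>" and n: "\<And>i. n $ i \<in> \<int>"
  shows "h n \<in> \<int>"
proof -
  obtain W where W: "subrep \<rho> W" "is_weight_of \<rho> W h" using weights_cases[OF h] by metis
  obtain w where w: "w \<in> W" "w \<noteq> 0" using weight_space_nontrivial[OF rep W] by blast
  have "torus_exp n = torus_exp 0" using n by (simp add: torus_exp_eq_iff)
  then have "act \<rho> n w = w" using act_0[OF rep] by (simp add: act_def)
  then show ?thesis using act_fixes_iff[OF W w] by simp
qed

text \<open>A sum of vectors from mutually orthogonal invariant planes is fixed if and only if each
  summand is.\<close>

lemma exists_isotropy_of_weights: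
  assumes S: "finite S" "S \<subseteq> weights \<rho>" and pm: "\<forall>a\<in>S. \<forall>b\<in>S. a \<noteq> b \<longrightarrow> a \<noteq> - b"
  obtains v where "\<And>x. act \<rho> x v = v \<longleftrightarrow> (\<forall>s\<in>S. blinfun_apply s x \<in> \<int>)"
proof -
  have "\<forall>s\<in>S. \<exists>W w. subrep \<rho> W \<and> is_weight_of \<rho> W s \<and> w \<in> W \<and> w \<noteq> 0"
    using S(2) weights_cases weight_space_nontrivial[OF rep] by (metis subsetD)
  then obtain U u where U: "\<And>s. s \<in> S \<Longrightarrow> subrep \<rho> (U s)" "\<And>s. s \<in> S \<Longrightarrow> is_weight_of \<rho> (U s) s"
    "\<And>s. s \<in> S \<Longrightarrow> u s \<in> U s" "\<And>s. s \<in> S \<Longrightarrow> u s \<noteq> 0"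
    by metis
  define v where "v = (\<Sum>s\<in>S. u s)"
  have "act \<rho> x v = v \<longleftrightarrow> (\<forall>s\<in>S. act \<rho> x (u s) = u s)" for x
  proof
    assume eq: "act \<rho> x v = v"
    let ?d = "\<lambda>s. act \<rho> x (u s) - u s"
    have dU: "?d s \<in> U s" if "s \<in> S" for s
      using U(1,3)[OF that] by (simp add: subrep_iff_act[OF rep] subspace_diff)
    have sum: "(\<Sum>s\<in>S. ?d s) = 0"
      using eq by (simp add: v_def sum_subtractf linear_sum[OF linear_act[OF rep]])
    show "\<forall>s\<in>S. act \<rho> x (u s) = u s"
    proof
      fix s assume s: "s \<in> S"
      have orth: "?d t \<bullet> ?d s = 0" if t: "t \<in> S" "t \<noteq> s" for t
        using weight_vectors_orthogonal[OF U(1,2)[OF t(1)] U(1,2)[OF s] _ _ dU[OF t(1)] dU[OF s]]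
          pm s t by auto
      have "0 = (\<Sum>t\<in>S. ?d t) \<bullet> ?d s" using sum by simp
      also have "\<dots> = (\<Sum>t\<in>S. ?d t \<bullet> ?d s)" by (rule inner_sum_left)
      also have "\<dots> = (\<Sum>t\<in>{s}. ?d t \<bullet> ?d s)"
        using S(1) s orth by (intro sum.mono_neutral_right) auto
      finally show "act \<rho> x (u s) = u s" by simp
    qed
  qed (simp add: v_def linear_sum[OF linear_act[OF rep]])
  then show thesis using that act_fixes_iff[OF U] by auto
qed

text \<open>The points \<open>exp u\<close> with \<open>s(u) = 0\<close> for all \<open>s \<in> S\<close> form a subgroup of the isotropy group, whose cosets are
  the classes of the relation \<open>R\<close>. It is open: near a given point the quotient of two elements of
  the isotropy group is \<open>exp u\<close> with \<open>u\<close> small, and a small integer \<open>s(u)\<close> is zero. So there is only one class.\<close>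

lemma annihilator_lift:
  assumes conn: "\<And>v. connected (isotropy_group \<rho> v)"
    and S: "finite S" "S \<subseteq> weights \<rho>" and pm: "\<forall>a\<in>S. \<forall>b\<in>S. a \<noteq> b \<longrightarrow> a \<noteq> - b"
    and y: "\<And>s. s \<in> S \<Longrightarrow> blinfun_apply s y \<in> \<int>"
  obtains n where "\<And>i. n $ i \<in> \<int>" "\<And>s. s \<in> S \<Longrightarrow> blinfun_apply s (y - n) = 0"
proof -
  obtain v where v: "\<And>x. act \<rho> x v = v \<longleftrightarrow> (\<forall>s\<in>S. blinfun_apply s x \<in> \<int>)"
    using exists_isotropy_of_weights[OF S pm] by blast
  define K where "K = isotropy_group \<rho> v"
  have K: "K = torus_exp ` {x. \<forall>s\<in>S. blinfun_apply s x \<in> \<int>}"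
    unfolding K_def isotropy_group_act[OF rep] v ..
  define R where "R = (\<lambda>z z'. \<exists>u :: real ^ 'd. z' = z * torus_exp u \<and> (\<forall>s\<in>S. blinfun_apply s u = 0))"
  have "R (torus_exp 0) (torus_exp y)"
  proof (rule connected_equivalence_relation[of K])
    show "connected K" unfolding K_def by (rule conn)
    show "torus_exp 0 \<in> K" unfolding K by (rule imageI) simp
    show "torus_exp y \<in> K" unfolding K by (rule imageI) (simp add: y)
    fix a b c
    show "R b a" if "R a b"
    proof -
      obtain u where u: "b = a * torus_exp u" "\<forall>s\<in>S. blinfun_apply s u = 0"
        using \<open>R a b\<close> by (auto simp: R_def)
      have "torus_exp u * torus_exp (- u) = (1 :: complex ^ 'd)"
        by (simp flip: torus_exp_add) (simp add: torus_exp_def vec_eq_iff)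
      then have "a = b * torus_exp (- u)" using u(1) by (simp add: mult.assoc)
      then show ?thesis using u(2) unfolding R_def by (intro exI[of _ "- u"]) (simp add: blinfun.minus_right)
    qed
    show "R a c" if "R a b" "R b c"
    proof -
      obtain u u' where "b = a * torus_exp u" "c = b * torus_exp u'"
        "\<forall>s\<in>S. blinfun_apply s u = 0" "\<forall>s\<in>S. blinfun_apply s u' = 0"
        using \<open>R a b\<close> \<open>R b c\<close> by (auto simp: R_def)
      then show ?thesis unfolding R_def
        by (intro exI[of _ "u + u'"]) (simp add: torus_exp_add blinfun.add_right mult.assoc)
    qed
  next
    fix a assume aK: "a \<in> K"
    then obtain \<alpha> where \<alpha>: "a = torus_exp \<alpha>" "\<And>s. s \<in> S \<Longrightarrow> blinfun_apply s \<alpha> \<in> \<int>" unfolding K by blast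
    have a1: "cmod (a $ i) = 1" for i by (simp add: \<alpha>(1) torus_exp_def)
    then have a0: "a $ i \<noteq> 0" for i by (metis norm_zero zero_neq_one)
    define u where "u = (\<lambda>z :: complex ^ 'd. \<chi> i. Arg (z $ i / a $ i) / (2 * pi))"
    \<comment> \<open>A bound for the norms of all s, with 1 added to make it strict, and positive if S is empty.\<close>
    define M where "M = (\<Sum>s\<in>S. norm s) + 1"
    have M: "M > 0" "\<And>s. s \<in> S \<Longrightarrow> norm s < M"
      using S(1) by (auto simp: M_def sum_nonneg add_nonneg_pos intro!: le_imp_less_Suc
          member_le_sum[of _ S norm, THEN le_less_trans])
    have "(u \<longlongrightarrow> u a) (at a)"
    proof -
      have "((\<lambda>z. Arg (z $ i / a $ i) / (2 * pi)) \<longlongrightarrow> Arg (a $ i / a $ i) / (2 * pi)) (at a)" for i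
      proof -
        have "isCont Arg (a $ i / a $ i)" using a0 by (intro continuous_at_Arg) simp
        moreover have "((\<lambda>z. z $ i / a $ i) \<longlongrightarrow> a $ i / a $ i) (at a)"
          by (intro tendsto_intros) (simp_all add: a0)
        ultimately have "((\<lambda>z. Arg (z $ i / a $ i)) \<longlongrightarrow> Arg (a $ i / a $ i)) (at a)"
          by (rule isCont_tendsto_compose)
        then show ?thesis by (intro tendsto_divide tendsto_const) auto
      qed
      then show ?thesis unfolding u_def by (intro tendsto_vec_lambda)
    qed
    moreover have "u a = 0" using a0 by (simp add: u_def vec_eq_iff)
    ultimately obtain \<delta> where \<delta>: "\<delta> > 0" "\<And>z. dist z a < \<delta> \<Longrightarrow> norm (u z) < 1 / M"
      using M(1) unfolding tendsto_iff eventually_at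
      by (metis (no_types, lifting) UNIV_I dist_0_norm dist_commute dist_self norm_zero zero_less_divide_1_iff)
    have "R a z" if z: "z \<in> K" "dist z a < \<delta>" for z
    proof -
      obtain \<zeta> where \<zeta>: "z = torus_exp \<zeta>" "\<And>s. s \<in> S \<Longrightarrow> blinfun_apply s \<zeta> \<in> \<int>"
        using z(1) unfolding K by blast
      have z1: "cmod (z $ i) = 1" for i by (simp add: \<zeta>(1) torus_exp_def)
      then have z0: "z $ i \<noteq> 0" for i by (metis norm_zero zero_neq_one)
      have "sgn (z $ i / a $ i) = z $ i / a $ i" for i using a1 z1 by (simp add: sgn_eq norm_divide)
      then have za: "z = a * torus_exp (u z)"
        using a0 z0 by (simp add: vec_eq_iff u_def torus_exp_def cis_Arg)
      then have "torus_exp \<zeta> = torus_exp (\<alpha> + u z)" using \<alpha>(1) \<zeta>(1) by (simp add: torus_exp_add)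
      then have lattice: "\<And>i. (\<zeta> - (\<alpha> + u z)) $ i \<in> \<int>" by (simp only: torus_exp_eq_iff)
      have "blinfun_apply s (u z) = 0" if s: "s \<in> S" for s
      proof -
        have "blinfun_apply s (\<zeta> - (\<alpha> + u z)) \<in> \<int>"
          using weight_integral_on_lattice[OF _ lattice] s S(2) by blast
        then have "blinfun_apply s \<zeta> - blinfun_apply s \<alpha> - blinfun_apply s (\<zeta> - (\<alpha> + u z)) \<in> \<int>"
          using \<zeta>(2)[OF s] \<alpha>(2)[OF s] by (intro Ints_diff)
        then have int: "blinfun_apply s (u z) \<in> \<int>" by (simp add: blinfun.diff_right blinfun.add_right)
        have "\<bar>blinfun_apply s (u z)\<bar> \<le> norm s * norm (u z)" using norm_blinfun[of s "u z"] by simp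
        also have "\<dots> \<le> M * norm (u z)" using M(2)[OF s] by (intro mult_right_mono) auto
        also have "\<dots> < M * (1 / M)" using M(1) \<delta>(2)[OF z(2)] by (intro mult_strict_left_mono) auto
        also have "\<dots> = 1" using M(1) by simp
        finally show ?thesis using Ints_nonzero_abs_less1[OF int] by blast
      qed
      then show ?thesis using za unfolding R_def by blast
    qed
    then show "\<exists>T. openin (top_of_set K) T \<and> a \<in> T \<and> (\<forall>z\<in>T. R a z)"
      using \<delta>(1) aK by (intro exI[of _ "K \<inter> ball a \<delta>"]) (auto simp: dist_commute openin_open)
  qed
  then obtain u where u: "torus_exp y = torus_exp (0 + u)" "\<And>s. s \<in> S \<Longrightarrow> blinfun_apply s u = 0"
    unfolding R_def torus_exp_add by blast
  then have "\<And>i. (y - u) $ i \<in> \<int>" by (simp only: torus_exp_eq_iff) simp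
  moreover have "\<And>s. s \<in> S \<Longrightarrow> blinfun_apply s (y - (y - u)) = 0" using u(2) by simp
  ultimately show thesis using that by blast
qed

end

section \<open>Unimodularity of the weights\<close>

text \<open>The vector that represents a functional, used to transfer dimension and orthogonality arguments
  to functionals.\<close>

definition riesz :: "('a::euclidean_space \<Rightarrow>\<^sub>L real) \<Rightarrow> 'a" where
  "riesz h = (\<Sum>i\<in>Basis. blinfun_apply h i *\<^sub>R i)"

lemma riesz_inner: "riesz h \<bullet> x = blinfun_apply h x"
proof -
  have "riesz h \<bullet> x = (\<Sum>i\<in>Basis. (x \<bullet> i) * blinfun_apply h i)"
    unfolding riesz_def inner_sum_left by (simp add: inner_commute mult.commute)
  also have "\<dots> = blinfun_apply h (\<Sum>i\<in>Basis. (x \<bullet> i) *\<^sub>R i)"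
    by (simp add: blinfun.sum_right blinfun.scaleR_right)
  finally show ?thesis by (simp add: euclidean_representation)
qed

lemma linear_riesz: "linear riesz"
  by (rule linearI) (simp_all add: riesz_def blinfun.add_left blinfun.scaleR_left sum.distrib
      scaleR_left_distrib scaleR_sum_right)

lemma inj_riesz: "inj riesz"
  by (rule injI) (metis blinfun_eqI riesz_inner)

lemma rank_at_most_functionals: "rank_at_most (W :: ('a::euclidean_space \<Rightarrow>\<^sub>L real) set) DIM('a)"
  unfolding rank_at_most_def
proof (intro allI impI)
  fix S :: "('a \<Rightarrow>\<^sub>L real) set" assume "independent S"
  then have "independent (riesz ` S)"
    using linear_independent_injective_image[OF linear_riesz] inj_riesz inj_on_subset by blast
  then have "finite (riesz ` S) \<and> card (riesz ` S) \<le> DIM('a)" using independent_bound by blast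
  moreover have inj: "inj_on riesz S" using inj_riesz inj_on_subset by blast
  ultimately show "finite S \<and> card S \<le> DIM('a)" using finite_imageD card_image by metis
qed

text \<open>The component of \<open>b\<close> orthogonal to the other functionals, rescaled.\<close>

lemma dual_vector_exists:
  fixes S :: "('a::euclidean_space \<Rightarrow>\<^sub>L real) set"
  assumes S: "independent S" and b: "b \<in> S"
  obtains y where "blinfun_apply b y = 1" "\<And>s. s \<in> S \<Longrightarrow> s \<noteq> b \<Longrightarrow> blinfun_apply s y = 0"
proof -
  let ?T = "riesz ` (S - {b})"
  obtain p z where pz: "p \<in> span ?T" "\<And>w. w \<in> span ?T \<Longrightarrow> orthogonal z w" "riesz b = p + z"
    using orthogonal_subspace_decomp_exists by blast
  have "riesz b \<notin> span ?T"
  proof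
    assume "riesz b \<in> span ?T"
    then have "b \<in> span (S - {b})"
      using inj_riesz unfolding linear_span_image[OF linear_riesz] by (auto dest: injD)
    then show False using S b dependent_def by blast
  qed
  then have "z \<noteq> 0" using pz(1,3) by auto
  then have zz: "z \<bullet> z \<noteq> 0" by simp
  let ?y = "z /\<^sub>R (z \<bullet> z)"
  have "blinfun_apply b ?y = 1"
    using pz(2)[OF pz(1)] zz unfolding riesz_inner[symmetric] pz(3)
    by (simp add: inner_add_left inner_add_right orthogonal_def inner_commute)
  moreover have "blinfun_apply s ?y = 0" if "s \<in> S" "s \<noteq> b" for s
    using pz(2)[OF span_base, of "riesz s"] that unfolding riesz_inner[symmetric]
    by (simp add: orthogonal_def inner_commute)
  ultimately show thesis by (rule that)
qed

lemma independent_no_antipodes: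
  fixes S :: "('a::euclidean_space \<Rightarrow>\<^sub>L real) set"
  assumes S: "independent S" and ab: "a \<in> S" "b \<in> S" "a \<noteq> b"
  shows "a \<noteq> - b"
proof
  assume "a = - b"
  obtain y where "blinfun_apply b y = 1" "\<And>s. s \<in> S \<Longrightarrow> s \<noteq> b \<Longrightarrow> blinfun_apply s y = 0"
    using dual_vector_exists[OF S ab(2)] by blast
  then show False using ab \<open>a = - b\<close> by (metis blinfun.minus_left neg_equal_0_iff_equal zero_neq_one)
qed

text \<open>Apply \<open>annihilator_lift\<close> to a vector dual to \<open>b\<close>, once with \<open>S\<close> and, after rescaling, once with \<open>x\<close> in place of
  \<open>b\<close>. This makes both the coefficient \<open>c b\<close> and its inverse integral.\<close>

lemma unimodular_weights:
  fixes \<rho> :: "complex ^ 'd \<Rightarrow> 'v::euclidean_space \<Rightarrow> 'v"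
  assumes rep: "torus_rep \<rho>" and conn: "\<And>v. connected (isotropy_group \<rho> v)"
  shows "unimodular_system (weights \<rho>)"
  unfolding unimodular_system_def
proof (intro conjI allI impI ballI)
  show "0 \<notin> weights \<rho>" by (auto simp: weights_def is_weight_of_def)
  show "- x \<in> weights \<rho>" if "x \<in> weights \<rho>" for x using that by (rule weights_uminus)
  fix S c b
  assume S: "finite S" "S \<subseteq> weights \<rho>" "independent S" and x: "(\<Sum>b\<in>S. c b *\<^sub>R b) \<in> weights \<rho>" and b: "b \<in> S"
  define x where "x = (\<Sum>b\<in>S. c b *\<^sub>R b)"
  have xw: "x \<in> weights \<rho>" using x by (simp add: x_def)
  have bw: "b \<in> weights \<rho>" using S(2) b by blast
  have x_apply: "blinfun_apply x z = c b * blinfun_apply b z"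
    if "\<And>s. s \<in> S \<Longrightarrow> s \<noteq> b \<Longrightarrow> blinfun_apply s z = 0" for z
  proof -
    have "blinfun_apply x z = (\<Sum>s\<in>S. c s * blinfun_apply s z)"
      by (simp add: x_def blinfun.sum_left blinfun.scaleR_left)
    also have "\<dots> = (\<Sum>s\<in>{b}. c s * blinfun_apply s z)"
      using S(1) b that by (intro sum.mono_neutral_right) auto
    finally show ?thesis by simp
  qed
  obtain y where y: "blinfun_apply b y = 1" "\<And>s. s \<in> S \<Longrightarrow> s \<noteq> b \<Longrightarrow> blinfun_apply s y = 0"
    using dual_vector_exists[OF S(3) b] by blast
  have xy: "blinfun_apply x y = c b" using x_apply[OF y(2)] y(1) by simp
  show "c b \<in> {-1, 0, 1}"
  proof (cases "c b = 0")
    case False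
    have pmS: "\<forall>a\<in>S. \<forall>a'\<in>S. a \<noteq> a' \<longrightarrow> a \<noteq> - a'" using independent_no_antipodes[OF S(3)] by blast
    have yS: "blinfun_apply s y \<in> \<int>" if "s \<in> S" for s using y that by (cases "s = b") auto
    obtain n where n: "\<And>i. n $ i \<in> \<int>" "\<And>s. s \<in> S \<Longrightarrow> blinfun_apply s (y - n) = 0"
      using annihilator_lift[OF rep conn S(1,2) pmS yS] by metis
    have "blinfun_apply x (y - n) = 0" using x_apply[OF n(2)] n(2)[OF b] by simp
    then have "c b = blinfun_apply x n" using xy by (simp add: blinfun.diff_right)
    then have int1: "c b \<in> \<int>" using weight_integral_on_lattice[OF rep xw n(1)] by simp
    \<comment> \<open>Exchanging b for x: the rescaled dual vector is 1 on x and 0 on the other elements.\<close>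
    let ?S = "insert x (S - {b})"
    have xS: "x \<noteq> s" "x \<noteq> - s" "s \<noteq> - x" if "s \<in> S - {b}" for s
      using y(2)[of s] xy that False by (auto simp: blinfun.minus_left)
    have pm': "\<forall>a\<in>?S. \<forall>a'\<in>?S. a \<noteq> a' \<longrightarrow> a \<noteq> - a'"
    proof (intro ballI impI)
      fix a a' assume a: "a \<in> ?S" "a' \<in> ?S" "a \<noteq> a'"
      then consider "a = x" "a' \<in> S - {b}" | "a \<in> S - {b}" "a' = x" | "a \<in> S" "a' \<in> S" by blast
      then show "a \<noteq> - a'"
      proof cases
        case 1
        then show ?thesis using xS(2) by simp
      next
        case 2
        then show ?thesis using xS(3) by simp
      next
        case 3
        then show ?thesis using pmS a(3) by blast
      qed
    qed
    have z: "blinfun_apply x (y /\<^sub>R c b) = 1" "\<And>s. s \<in> S \<Longrightarrow> s \<noteq> b \<Longrightarrow> blinfun_apply s (y /\<^sub>R c b) = 0"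
      using xy y(2) False by (simp_all add: blinfun.scaleR_right)
    have zS: "blinfun_apply s (y /\<^sub>R c b) \<in> \<int>" if "s \<in> ?S" for s
      using that z by (cases "s = x") auto
    have S': "finite ?S" "?S \<subseteq> weights \<rho>" using S(1,2) xw by auto
    obtain m where m: "\<And>i. m $ i \<in> \<int>" "\<And>s. s \<in> ?S \<Longrightarrow> blinfun_apply s (y /\<^sub>R c b - m) = 0"
      using annihilator_lift[OF rep conn S' pm' zS] by metis
    have "c b * blinfun_apply b (y /\<^sub>R c b - m) = blinfun_apply x (y /\<^sub>R c b - m)"
      using m(2) by (intro x_apply[symmetric]) auto
    also have "\<dots> = 0" using m(2) by blast
    finally have "blinfun_apply b (y /\<^sub>R c b) = blinfun_apply b m" using False by (simp add: blinfun.diff_right)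
    moreover have "blinfun_apply b (y /\<^sub>R c b) = inverse (c b)" using y(1) by (simp add: blinfun.scaleR_right)
    ultimately have int2: "inverse (c b) \<in> \<int>" using weight_integral_on_lattice[OF rep bw m(1)] by simp
    have "\<bar>c b\<bar> \<ge> 1" "\<bar>inverse (c b)\<bar> \<ge> 1"
      using Ints_nonzero_abs_ge1[OF int1] Ints_nonzero_abs_ge1[OF int2] False by auto
    then have "\<bar>c b\<bar> = 1" using False by (simp add: field_simps)
    then show ?thesis by (auto simp: abs_if split: if_splits)
  qed simp
qed

section \<open>Families and weights\<close>

text \<open>Two opposite weights belong to each member, and no weight belongs to two inequivalent members.\<close>

lemma inequivalent_family_card:
  fixes \<rho> :: "complex ^ 'd \<Rightarrow> 'v::euclidean_space \<Rightarrow> 'v"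
  assumes rep: "torus_rep \<rho>" and fin: "finite (weights \<rho>)" and F: "inequivalent_family \<rho> F"
  shows "finite F \<and> 2 * card F \<le> card (weights \<rho>)"
proof -
  have sub: "subrep \<rho> W" and nt: "W \<in> nontrivial_irreducible_subreps \<rho>" if "W \<in> F" for W
    using F that by (auto simp: inequivalent_family_def nontrivial_irreducible_subreps_def irreducible_subrep_def)
  have "\<forall>W\<in>F. \<exists>h. is_weight_of \<rho> W h" using nontrivial_irreducible_has_weight[OF rep] nt by metis
  then obtain h where h: "\<And>W. W \<in> F \<Longrightarrow> is_weight_of \<rho> W (h W)" by metis
  define g where "g = (\<lambda>(W, positive). if positive then h W else - h W)"
  have g_weight: "is_weight_of \<rho> W (g (W, p))" if "W \<in> F" for W p
    using h[OF that] weight_uminus by (auto simp: g_def)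
  have nz: "h W \<noteq> - h W" if "W \<in> F" for W
  proof
    assume "h W = - h W"
    then have "2 *\<^sub>R h W = 0" by (metis add.right_inverse scaleR_2)
    then show False using h[OF that] by (simp add: is_weight_of_def)
  qed
  have inj: "inj_on g (F \<times> UNIV)"
  proof (rule inj_onI, clarify)
    fix W p W' p' assume W: "W \<in> F" "W' \<in> F" and eq: "g (W, p) = g (W', p')"
    have "equivalent_subreps \<rho> W W'"
      using same_weight_equivalent_subreps[OF rep sub[OF W(1)] g_weight[OF W(1), of p] sub[OF W(2)]]
        g_weight[OF W(2), of p'] eq by simp
    then have "W = W'" using F W by (auto simp: inequivalent_family_def pairwise_def)
    moreover have "p = p'" using eq nz[OF W(1)] \<open>W = W'\<close> by (cases p; cases p') (auto simp: g_def)
    ultimately show "W = W' \<and> p = p'" by blast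
  qed
  moreover have "g ` (F \<times> UNIV) \<subseteq> weights \<rho>" using g_weight nt by (auto simp: weights_def)
  ultimately have "finite (F \<times> (UNIV :: bool set))" "card (F \<times> (UNIV :: bool set)) \<le> card (weights \<rho>)"
    using fin by (auto intro: inj_on_finite card_inj_on_le)
  then show ?thesis by (auto simp: card_cartesian_product finite_cartesian_product_iff)
qed

lemma power_two_differences_unique:
  fixes i j k l :: nat
  assumes "i < j" "k < l" and eq: "(2::real) ^ j - 2 ^ i = 2 ^ l - 2 ^ k"
  shows "i = k \<and> j = l"
proof -
  have less: "(2::real) ^ b - 2 ^ a < 2 ^ d - 2 ^ c" if "a < b" "c < d" "b < d" for a b c d :: nat
  proof -
    obtain m where m: "d = Suc m" using \<open>b < d\<close> by (cases d) auto
    then have "(2::real) ^ c \<le> 2 ^ m" "(2::real) ^ b \<le> 2 ^ m" "(0::real) < 2 ^ a" using that by auto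
    then show ?thesis unfolding m power_Suc by linarith
  qed
  have "j = l" using less[of i j k l] less[of k l i j] assms by (metis less_irrefl nat_neq_iff)
  then show ?thesis using eq by simp
qed

text \<open>The positive roots are indexed by the pairs \<open>i < j \<le> d\<close>, where \<open>i = 0\<close> stands for \<open>e j\<close> alone. A functional
  with value \<open>2 ^ i - 1\<close> at \<open>e i\<close> takes the values \<open>\<plusminus> (2 ^ j - 2 ^ i)\<close> on them and so tells them
  apart even up to sign.\<close>

lemma inequivalent_family_of_roots:
  fixes \<rho> :: "complex ^ 'd \<Rightarrow> 'v::euclidean_space \<Rightarrow> 'v" and e :: "nat \<Rightarrow> (real ^ 'd) \<Rightarrow>\<^sub>L real"
  assumes rep: "torus_rep \<rho>" and e: "is_basis_upto d e"
    and roots: "e ` {1..d} \<union> {e i - e j | i j. 1 \<le> i \<and> i < j \<and> j \<le> d} \<subseteq> weights \<rho>"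
  shows "\<exists>F. inequivalent_family \<rho> F \<and> finite F \<and> card F = d * (d + 1) div 2"
proof -
  have e_inj: "inj_on e {1..d}" and e_ind: "independent (e ` {1..d})" using e by (auto simp: is_basis_upto_def)
  obtain \<psi> :: "(real ^ 'd) \<Rightarrow>\<^sub>L real \<Rightarrow> real" where \<psi>: "linear \<psi>"
      "\<forall>x\<in>e ` {1..d}. \<psi> x = 2 ^ (inv_into {1..d} e x) - 1"
    using linear_independent_extend[OF e_ind, of "\<lambda>x. 2 ^ (inv_into {1..d} e x) - 1"] by blast
  have \<psi>_e: "\<psi> (e i) = 2 ^ i - 1" if "i \<in> {1..d}" for i using \<psi>(2) e_inj that by simp
  define P where "P = (SIGMA j:{..d}. {..<j})"
  define root where "root = (\<lambda>(j, i). if i = 0 then e j else e i - e j)"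
  have root_weight: "root p \<in> weights \<rho>" if "p \<in> P" for p
  proof -
    have "root p \<in> e ` {1..d} \<union> {e i - e j | i j. 1 \<le> i \<and> i < j \<and> j \<le> d}"
      using that by (auto simp: P_def root_def split: if_splits)
    then show ?thesis using roots by blast
  qed
  have \<psi>_root: "\<bar>\<psi> (root (j, i))\<bar> = 2 ^ j - 2 ^ i" if "(j, i) \<in> P" for i j
  proof -
    have ij: "i < j" "j \<le> d" using that by (auto simp: P_def)
    then have "(2::real) ^ i < 2 ^ j" by simp
    then show ?thesis using ij \<psi>_e[of i] \<psi>_e[of j]
      by (cases "i = 0") (simp_all add: root_def linear_diff[OF \<psi>(1)])
  qed
  have root_eq: "p = q" if "p \<in> P" "q \<in> P" "root q = root p \<or> root q = - root p" for p q
  proof -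
    obtain i j k l where pq: "p = (j, i)" "q = (l, k)" by (cases p; cases q) auto
    have "\<bar>\<psi> (root q)\<bar> = \<bar>\<psi> (root p)\<bar>" using that(3) by (auto simp: linear_neg[OF \<psi>(1)])
    then have "(2::real) ^ j - 2 ^ i = 2 ^ l - 2 ^ k" using \<psi>_root that(1,2) pq by simp
    then have "i = k \<and> j = l"
      using that(1,2) pq by (intro power_two_differences_unique) (auto simp: P_def)
    then show ?thesis using pq by simp
  qed
  have "\<forall>p\<in>P. \<exists>W. W \<in> nontrivial_irreducible_subreps \<rho> \<and> subrep \<rho> W \<and> is_weight_of \<rho> W (root p)"
    using root_weight weights_cases[OF rep] by metis
  then obtain U where U: "\<And>p. p \<in> P \<Longrightarrow> U p \<in> nontrivial_irreducible_subreps \<rho>"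
    "\<And>p. p \<in> P \<Longrightarrow> subrep \<rho> (U p)" "\<And>p. p \<in> P \<Longrightarrow> is_weight_of \<rho> (U p) (root p)"
    by metis
  have U_eq: "p = q" if "p \<in> P" "q \<in> P" "equivalent_subreps \<rho> (U p) (U q)" for p q
    using equivalent_subreps_weights[OF rep U(2,3)[OF that(1)] U(2,3)[OF that(2)] that(3)]
      root_eq[OF that(1,2)] by blast
  have "inj_on U P"
  proof (rule inj_onI)
    fix p q assume pq: "p \<in> P" "q \<in> P" "U p = U q"
    then have "is_weight_of \<rho> (U q) (root p)" using U(3)[OF pq(1)] by simp
    then have "equivalent_subreps \<rho> (U p) (U q)"
      using same_weight_equivalent_subreps[OF rep U(2,3)[OF pq(1)] U(2)[OF pq(2)]] by blast
    then show "p = q" using U_eq pq(1,2) by blast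
  qed
  then have "card (U ` P) = card P" by (rule card_image)
  also have "card P = (\<Sum>j\<le>d. j)" by (simp add: P_def card_SigmaI)
  also have "\<dots> = d * (d + 1) div 2" using gauss_sum_nat[of d] by (simp add: atMost_atLeast0)
  finally have "card (U ` P) = d * (d + 1) div 2" .
  moreover have "inequivalent_family \<rho> (U ` P)"
    using U(1) U_eq unfolding inequivalent_family_def pairwise_def by blast
  moreover have "finite (U ` P)" by (simp add: P_def)
  ultimately show ?thesis by blast
qed

lemma differences_enumerated:
  fixes e :: "nat \<Rightarrow> 'a::ab_group_add"
  assumes e: "bij_betw e {1..d} E"
    and R: "R = e ` {1..d} \<union> {e i - e j | i j. 1 \<le> i \<and> i < j \<and> j \<le> d}"
  shows "E \<union> uminus ` E \<union> {a - b | a b. a \<in> E \<and> b \<in> E \<and> a \<noteq> b} = R \<union> uminus ` R"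
proof -
  have E: "E = e ` {1..d}" using e by (simp add: bij_betw_def)
  have inj: "inj_on e {1..d}" using e by (simp add: bij_betw_def)
  define D where "D = {a - b | a b. a \<in> E \<and> b \<in> E \<and> a \<noteq> b}"
  have "a - b \<in> R \<union> uminus ` R" if ab: "a \<in> E" "b \<in> E" "a \<noteq> b" for a b
  proof -
    obtain i j where ij: "i \<in> {1..d}" "j \<in> {1..d}" "a = e i" "b = e j" using ab E by auto
    show ?thesis
    proof (cases "i < j")
      case True
      then show ?thesis unfolding R using ij by auto
    next
      case False
      then have "j < i" using ij ab(3) by (metis nat_neq_iff)
      then have "e j - e i \<in> R" unfolding R using ij by auto
      moreover have "a - b = - (e j - e i)" using ij by simp
      ultimately show ?thesis by blast
    qed
  qed
  then have "D \<subseteq> R \<union> uminus ` R" unfolding D_def by blast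
  moreover have "r \<in> E \<union> D \<and> - r \<in> uminus ` E \<union> D" if r: "r \<in> R" for r
  proof (cases "r \<in> E")
    case False
    then obtain i j where ij: "r = e i - e j" "1 \<le> i" "i < j" "j \<le> d" using r unfolding R E by auto
    then have "i \<in> {1..d}" "j \<in> {1..d}" "i \<noteq> j" by auto
    then have e_ij: "e i \<in> E" "e j \<in> E" "e i \<noteq> e j" using E inj_on_eq_iff[OF inj] by blast+
    have neg: "- r = e j - e i" using ij by simp
    have "r \<in> D" unfolding D_def ij(1) using e_ij by blast
    moreover have "- r \<in> D" unfolding D_def neg using e_ij(1,2) e_ij(3)[symmetric] by blast
    ultimately show ?thesis by blast
  qed auto
  then have "R \<subseteq> E \<union> D" "uminus ` R \<subseteq> uminus ` E \<union> D" by auto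
  moreover have "E \<subseteq> R" "uminus ` E \<subseteq> uminus ` R" using E R by auto
  ultimately show ?thesis unfolding D_def[symmetric] by blast
qed

theorem theoremG:
  fixes \<rho> :: "complex ^ 'd \<Rightarrow> 'v::euclidean_space \<Rightarrow> 'v"
    and d :: nat
  assumes d: "d = CARD('d)"
    and faithful: "faithful_rep \<rho>"
    and connected_isotropy: "\<And>v. connected (isotropy_group \<rho> v)"
  shows "(\<forall>\<F>. inequivalent_family \<rho> \<F> \<longrightarrow> finite \<F> \<and> card \<F> \<le> d * (d + 1) div 2) \<and>
    ((\<exists>\<F>. inequivalent_family \<rho> \<F> \<and> finite \<F> \<and> card \<F> = d * (d + 1) div 2) \<longleftrightarrow>
     (\<exists>e :: nat \<Rightarrow> ((real ^ 'd) \<Rightarrow>\<^sub>L real). is_basis_upto d e \<and>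
        (let R = e ` {1..d} \<union> {e i - e j | i j. 1 \<le> i \<and> i < j \<and> j \<le> d}
         in weights \<rho> = R \<union> uminus ` R)))"
proof -
  have rep: "torus_rep \<rho>" using faithful by (simp add: faithful_rep_def)
  have W: "unimodular_system (weights \<rho>)" by (rule unimodular_weights[OF rep connected_isotropy])
  have rank: "rank_at_most W d" for W :: "((real ^ 'd) \<Rightarrow>\<^sub>L real) set"
    using rank_at_most_functionals[of W] by (simp add: d)
  have le: "card (weights \<rho>) \<le> d * (d + 1)" by (rule card_unimodular_le[OF W rank])
  have family: "finite F" "2 * card F \<le> card (weights \<rho>)" if "inequivalent_family \<rho> F" for F
    using inequivalent_family_card[OF rep unimodular_finite[OF W rank] that] by auto
  have "even (d * (d + 1))" by simp
  then have half: "2 * (d * (d + 1) div 2) = d * (d + 1)" by (rule dvd_mult_div_cancel)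
  show ?thesis
  proof (intro conjI allI impI iffI)
    fix F assume F: "inequivalent_family \<rho> F"
    show "finite F" by (rule family(1)[OF F])
    show "card F \<le> d * (d + 1) div 2" using family(2)[OF F] le half by linarith
  next
    assume "\<exists>F. inequivalent_family \<rho> F \<and> finite F \<and> card F = d * (d + 1) div 2"
    then have card: "card (weights \<rho>) = d * (d + 1)" using family(2) le half by fastforce
    have pos: "d > 0" by (simp add: d)
    obtain E where E: "finite E" "independent E" "card E = d"
      "weights \<rho> = E \<union> uminus ` E \<union> {a - b | a b. a \<in> E \<and> b \<in> E \<and> a \<noteq> b}"
      by (rule extremal_unimodular[OF W rank card pos])
    obtain e where e: "bij_betw e {1..d} E" using ex_bij_betw_nat_finite_1[OF E(1)] E(3) by blast
    have "span E = UNIV"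
    proof (rule ccontr)
      assume "span E \<noteq> UNIV"
      then obtain x where x: "x \<notin> span E" by blast
      then have "independent (insert x E)" using E(2) by (rule independent_insertI)
      then have "card (insert x E) \<le> d" using rank[of UNIV] by (simp add: rank_at_most_def)
      moreover have "x \<notin> E" using x span_base by blast
      ultimately show False using E(1,3) by simp
    qed
    then have "is_basis_upto d e" using e E(2) by (simp add: is_basis_upto_def bij_betw_def)
    then show "\<exists>e. is_basis_upto d e \<and>
        (let R = e ` {1..d} \<union> {e i - e j | i j. 1 \<le> i \<and> i < j \<and> j \<le> d}
         in weights \<rho> = R \<union> uminus ` R)"
      using trans[OF E(4) differences_enumerated[OF e refl]] unfolding Let_def by blast
  next
    assume "\<exists>e. is_basis_upto d e \<and>
        (let R = e ` {1..d} \<union> {e i - e j | i j. 1 \<le> i \<and> i < j \<and> j \<le> d}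
         in weights \<rho> = R \<union> uminus ` R)"
    then obtain e where e: "is_basis_upto d e"
      "let R = e ` {1..d} \<union> {e i - e j | i j. 1 \<le> i \<and> i < j \<and> j \<le> d}
       in weights \<rho> = R \<union> uminus ` R" by blast
    have "e ` {1..d} \<union> {e i - e j | i j. 1 \<le> i \<and> i < j \<and> j \<le> d} \<subseteq> weights \<rho>"
      unfolding e(2)[unfolded Let_def] by (rule Un_upper1)
    with e(1) show "\<exists>F. inequivalent_family \<rho> F \<and> finite F \<and> card F = d * (d + 1) div 2"
      by (rule inequivalent_family_of_roots[OF rep])
  qed
qed

end
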